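(* Let $n\ge2$, $\boldsymbol\lambda=(\lambda_1,\dots,\lambda_n)$ and $\boldsymbol\mu=(\mu_1,\mu_2)$ with positive entries. The tuple of multiplication operators $(M_{z_1},\dots,M_{z_n})$ on $\boldsymbol A^{(\boldsymbol\lambda,\boldsymbol\mu)}(\mathbb D^n)$ corresponding to the coordinate functions is homogeneous under the action of the group $\text{Möb}^n$.
   Context: $\mathbb D$ is the open unit disc and $\text{Möb}$ its group of biholomorphic automorphisms. A commuting $n$-tuple $\boldsymbol T$ of bounded operators is homogeneous with respect to $\text{Möb}^n$ if its joint spectrum lies in $\overline{\mathbb D}^n$ and $(g_1(T_1),\dots,g_n(T_n))$ is simultaneously unitarily equivalent to $\boldsymbol T$ for all $(g_1,\dots,g_n)\in\text{Möb}^n$. $\boldsymbol A^{(\boldsymbol\lambda,\boldsymbol\mu)}(\mathbb D^n)$ is the reproducing kernel Hilbert space of $\mathbb C^3$-valued holomorphic functions on $\mathbb D^n$ with kernel $$K^{(\boldsymbol\lambda,\boldsymbol\mu)}(\boldsymbol z,\boldsymbol w)=D\begin{pmatrix}1&z_1&z_2\\ \bar w_1&\frac1{\lambda_1}+\mu_1^2+z_1\bar w_1&\bar w_1z_2\\ \bar w_2&z_1\bar w_2&\frac1{\lambda_2}+\mu_2^2+z_2\bar w_2\end{pmatrix}D\prod_{j=1}^n(1-z_j\bar w_j)^{-\lambda_j-2\delta_{1j}-2\delta_{2j}},$$ $D=\mathrm{diag}((1-z_1\bar w_1)(1-z_2\bar w_2),\,1-z_2\bar w_2,\,1-z_1\bar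 w_1)$, $\delta$ the Kronecker delta. *)

theory Defs
  imports
    "HOL-Complex_Analysis.Complex_Analysis"
    "HOL-Computational_Algebra.Polynomial"
    "HOL-Library.Function_Algebras"
begin

section \<open>Complex Hilbert spaces and bounded operators\<close>

text \<open>
  The spaces in question depend on real parameters, so a Hilbert space is a record with an explicit
  carrier. Addition is that of the ambient type. An operator is a function on the ambient type of
  which only the restriction to the carrier matters.
\<close>

record 'h hilbert =
  vecs :: "'h set"
  scl :: "complex \<Rightarrow> 'h \<Rightarrow> 'h"
  ip :: "'h \<Rightarrow> 'h \<Rightarrow> complex"

definition hnorm :: "'h hilbert \<Rightarrow> 'h \<Rightarrow> real" where
  "hnorm H x = sqrt (Re (ip H x x))"

locale chilbert_space =
  fixes H :: "'h::ab_group_add hilbert"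
  assumes zero_mem: "0 \<in> vecs H"
    and add_mem: "\<lbrakk>x \<in> vecs H; y \<in> vecs H\<rbrakk> \<Longrightarrow> x + y \<in> vecs H"
    and scl_mem: "x \<in> vecs H \<Longrightarrow> scl H a x \<in> vecs H"
    and scl_add_right: "\<lbrakk>x \<in> vecs H; y \<in> vecs H\<rbrakk> \<Longrightarrow> scl H a (x + y) = scl H a x + scl H a y"
    and scl_add_left: "x \<in> vecs H \<Longrightarrow> scl H (a + b) x = scl H a x + scl H b x"
    and scl_scl: "x \<in> vecs H \<Longrightarrow> scl H a (scl H b x) = scl H (a * b) x"
    and scl_one: "x \<in> vecs H \<Longrightarrow> scl H 1 x = x"
    and ip_add_left:
      "\<lbrakk>x \<in> vecs H; y \<in> vecs H; z \<in> vecs H\<rbrakk> \<Longrightarrow> ip H (x + y) z = ip H x z + ip H y z"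
    and ip_scl_left: "\<lbrakk>x \<in> vecs H; y \<in> vecs H\<rbrakk> \<Longrightarrow> ip H (scl H a x) y = a * ip H x y"
    and ip_commute: "\<lbrakk>x \<in> vecs H; y \<in> vecs H\<rbrakk> \<Longrightarrow> ip H y x = cnj (ip H x y)"
    and ip_pos: "\<lbrakk>x \<in> vecs H; x \<noteq> 0\<rbrakk> \<Longrightarrow> Re (ip H x x) > 0"
    and complete:
      "\<lbrakk>\<And>k::nat. X k \<in> vecs H;
        \<And>e. e > 0 \<Longrightarrow> \<exists>N. \<forall>j\<ge>N. \<forall>k\<ge>N. hnorm H (X j - X k) < e\<rbrakk>
       \<Longrightarrow> \<exists>x\<in>vecs H. (\<lambda>k. hnorm H (X k - x)) \<longlonglongrightarrow> 0"

definition linear_operator :: "'h::ab_group_add hilbert \<Rightarrow> ('h \<Rightarrow> 'h) \<Rightarrow> bool" where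
  "linear_operator H T \<longleftrightarrow>
     T \<in> vecs H \<rightarrow> vecs H \<and>
     (\<forall>x\<in>vecs H. \<forall>y\<in>vecs H. T (x + y) = T x + T y) \<and>
     (\<forall>a. \<forall>x\<in>vecs H. T (scl H a x) = scl H a (T x))"

definition bounded_operator :: "'h::ab_group_add hilbert \<Rightarrow> ('h \<Rightarrow> 'h) \<Rightarrow> bool" where
  "bounded_operator H T \<longleftrightarrow>
     linear_operator H T \<and> (\<exists>C. \<forall>x\<in>vecs H. hnorm H (T x) \<le> C * hnorm H x)"

definition unitary_operator :: "'h::ab_group_add hilbert \<Rightarrow> ('h \<Rightarrow> 'h) \<Rightarrow> bool" where
  "unitary_operator H U \<longleftrightarrow>
     linear_operator H U \<and> bij_betw U (vecs H) (vecs H) \<and>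
     (\<forall>x\<in>vecs H. \<forall>y\<in>vecs H. ip H (U x) (U y) = ip H x y)"

definition inverse_operators :: "'h::ab_group_add hilbert \<Rightarrow> ('h \<Rightarrow> 'h) \<Rightarrow> ('h \<Rightarrow> 'h) \<Rightarrow> bool" where
  "inverse_operators H T R \<longleftrightarrow>
     bounded_operator H T \<and> bounded_operator H R \<and> (\<forall>x\<in>vecs H. R (T x) = x \<and> T (R x) = x)"

definition commuting_tuple :: "'h::ab_group_add hilbert \<Rightarrow> ('n \<Rightarrow> 'h \<Rightarrow> 'h) \<Rightarrow> bool" where
  "commuting_tuple H T \<longleftrightarrow>
     (\<forall>i. bounded_operator H (T i)) \<and> (\<forall>i j. \<forall>x\<in>vecs H. T i (T j x) = T j (T i x))"

definition unitarily_equivalent ::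
  "'h::ab_group_add hilbert \<Rightarrow> ('n \<Rightarrow> 'h \<Rightarrow> 'h) \<Rightarrow> ('n \<Rightarrow> 'h \<Rightarrow> 'h) \<Rightarrow> bool" where
  "unitarily_equivalent H S T \<longleftrightarrow>
     (\<exists>U. unitary_operator H U \<and> (\<forall>i. \<forall>x\<in>vecs H. U (S i x) = T i (U x)))"

section \<open>The Taylor joint spectrum\<close>

text \<open>
  The degree \<open>p\<close> part of the Koszul complex, \<open>H \<otimes> \<Lambda>\<^sup>p \<complex>\<^sup>n\<close>, is realised as the
  space of alternating \<open>H\<close>-valued functions of \<open>p\<close> indices, so that no order on the index type is
  needed. The differential is \<open>\<xi> \<mapsto> (\<Sum>i. T i \<otimes> e\<^sub>i) \<and> \<xi>\<close>. The Koszul complex is self-dual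
  (up to signs and reversal of degrees), so exactness does not depend on using this cochain form.
\<close>

definition koszul_cochains :: "'h::ab_group_add hilbert \<Rightarrow> nat \<Rightarrow> ('n list \<Rightarrow> 'h) set" where
  "koszul_cochains H p =
     {\<xi>. (\<forall>is. length is = p \<longrightarrow> \<xi> is \<in> vecs H) \<and>
         (\<forall>is. length is \<noteq> p \<longrightarrow> \<xi> is = 0) \<and>
         (\<forall>as a b bs. \<xi> (as @ a # b # bs) = - \<xi> (as @ b # a # bs))}"

definition koszul_d ::
  "('n \<Rightarrow> 'h::ab_group_add \<Rightarrow> 'h) \<Rightarrow> ('n list \<Rightarrow> 'h) \<Rightarrow> 'n list \<Rightarrow> 'h" where
  "koszul_d T \<xi> is =
     (\<Sum>k<length is. let y = T (is ! k) (\<xi> (take k is @ drop (Suc k) is))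
                     in if even k then y else - y)"

definition koszul_exact :: "'h::ab_group_add hilbert \<Rightarrow> ('n \<Rightarrow> 'h \<Rightarrow> 'h) \<Rightarrow> bool" where
  "koszul_exact H T \<longleftrightarrow>
     (\<forall>\<xi>\<in>koszul_cochains H 0. koszul_d T \<xi> = (\<lambda>_. 0) \<longrightarrow> \<xi> = (\<lambda>_. 0)) \<and>
     (\<forall>p. \<forall>\<xi>\<in>koszul_cochains H (Suc p). koszul_d T \<xi> = (\<lambda>_. 0) \<longrightarrow>
        (\<exists>\<eta>\<in>koszul_cochains H p. \<xi> = koszul_d T \<eta>))"

definition taylor_spectrum ::
  "'h::ab_group_add hilbert \<Rightarrow> ('n::finite \<Rightarrow> 'h \<Rightarrow> 'h) \<Rightarrow> (complex^'n) set" where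
  "taylor_spectrum H T = {\<zeta>. \<not> koszul_exact H (\<lambda>i x. T i x - scl H (\<zeta> $ i) x)}"

section \<open>Homogeneous tuples\<close>

definition moeb :: "(complex \<Rightarrow> complex) set" where
  "moeb = {g. g holomorphic_on ball 0 1 \<and> g ` ball 0 1 \<subseteq> ball 0 1 \<and>
              (\<exists>h. h holomorphic_on ball 0 1 \<and> h ` ball 0 1 \<subseteq> ball 0 1 \<and>
                   (\<forall>z\<in>ball 0 1. h (g z) = z \<and> g (h z) = z))}"

definition poly_operator ::
  "'h::ab_group_add hilbert \<Rightarrow> complex poly \<Rightarrow> ('h \<Rightarrow> 'h) \<Rightarrow> 'h \<Rightarrow> 'h" where
  "poly_operator H p T x = (\<Sum>k\<le>degree p. scl H (coeff p k) ((T ^^ k) x))"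

text \<open>
  Rational functional calculus: \<open>S = g(T)\<close>, meaning \<open>S = p(T) q(T)\<^sup>-\<^sup>1\<close> where \<open>g = p / q\<close> on the
  disc. On the carrier, \<open>S\<close> depends only on \<open>g\<close> and \<open>T\<close>. Every automorphism of the disc is the
  restriction of a rational function without poles in the closed disc, hence \<open>g(T)\<close> exists for
  all \<open>g \<in> moeb\<close> as soon as the spectrum of \<open>T\<close> lies in the closed disc.
\<close>

definition is_apply :: "'h::ab_group_add hilbert \<Rightarrow> (complex \<Rightarrow> complex) \<Rightarrow> ('h \<Rightarrow> 'h) \<Rightarrow> ('h \<Rightarrow> 'h) \<Rightarrow> bool"
  where
  "is_apply H g T S \<longleftrightarrow>
     (\<exists>p q R. (\<forall>z\<in>ball 0 1. poly q z \<noteq> 0 \<and> g z = poly p z / poly q z) \<and>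
              inverse_operators H (poly_operator H q T) R \<and>
              (\<forall>x\<in>vecs H. S x = poly_operator H p T (R x)))"

definition homogeneous_tuple :: "'h::ab_group_add hilbert \<Rightarrow> ('n::finite \<Rightarrow> 'h \<Rightarrow> 'h) \<Rightarrow> bool" where
  "homogeneous_tuple H T \<longleftrightarrow>
     chilbert_space H \<and> commuting_tuple H T \<and>
     taylor_spectrum H T \<subseteq> {\<zeta>. \<forall>i. norm (\<zeta> $ i) \<le> 1} \<and>
     (\<forall>g. (\<forall>i. g i \<in> moeb) \<longrightarrow>
        (\<exists>S. (\<forall>i. is_apply H (g i) (T i) (S i)) \<and> unitarily_equivalent H S T))"

section \<open>Reproducing kernel Hilbert spaces\<close>

definition polydisc :: "(complex^'n) set" where
  "polydisc = {z. \<forall>i. norm (z $ i) < 1}"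

text \<open>For open \<open>\<Omega>\<close>: the real total derivative exists and is complex linear.\<close>

definition holo_on :: "(complex^'n \<Rightarrow> complex^'m) \<Rightarrow> (complex^'n) set \<Rightarrow> bool" where
  "holo_on f \<Omega> \<longleftrightarrow>
     (\<forall>z\<in>\<Omega>. \<exists>L. (f has_derivative L) (at z) \<and> (\<forall>c v. L (c *s v) = c *s L v))"

definition cvec_ip :: "complex^'m \<Rightarrow> complex^'m \<Rightarrow> complex" where
  "cvec_ip u v = (\<Sum>i\<in>UNIV. u $ i * cnj (v $ i))"

text \<open>Functions on \<open>\<Omega>\<close> are represented by their extension by zero.\<close>

definition kernel_section ::
  "'a set \<Rightarrow> ('a \<Rightarrow> 'a \<Rightarrow> complex^'m^'m) \<Rightarrow> 'a \<Rightarrow> complex^'m \<Rightarrow> 'a \<Rightarrow> complex^'m" where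
  "kernel_section \<Omega> K w \<zeta> = (\<lambda>z. if z \<in> \<Omega> then K z w *v \<zeta> else 0)"

definition is_rkhs ::
  "'a set \<Rightarrow> ('a \<Rightarrow> 'a \<Rightarrow> complex^'m^'m) \<Rightarrow> ('a \<Rightarrow> complex^'m) hilbert \<Rightarrow> bool" where
  "is_rkhs \<Omega> K H \<longleftrightarrow>
     chilbert_space H \<and>
     scl H = (\<lambda>c f z. c *s f z) \<and>
     (\<forall>f\<in>vecs H. \<forall>z. z \<notin> \<Omega> \<longrightarrow> f z = 0) \<and>
     (\<forall>w\<in>\<Omega>. \<forall>\<zeta>. kernel_section \<Omega> K w \<zeta> \<in> vecs H \<and>
        (\<forall>f\<in>vecs H. ip H f (kernel_section \<Omega> K w \<zeta>) = cvec_ip (f w) \<zeta>))"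

section \<open>The space and its multiplication operators\<close>

definition diag3 :: "complex \<Rightarrow> complex \<Rightarrow> complex \<Rightarrow> complex^3^3" where
  "diag3 a b c = vector [vector [a, 0, 0], vector [0, b, 0], vector [0, 0, c]]"

text \<open>
  The index type \<open>'n\<close> plays the role of \<open>{1, \<dots>, n}\<close>, and \<open>i\<close>, \<open>j\<close> are the indices numbered 1 and 2.
  The principal branch of the power is the right one since \<open>Re (1 - z $ k * cnj (w $ k)) > 0\<close>.
\<close>

definition kernelA ::
  "'n::finite \<Rightarrow> 'n \<Rightarrow> real^'n \<Rightarrow> real^2 \<Rightarrow> complex^'n \<Rightarrow> complex^'n \<Rightarrow> complex^3^3" where
  "kernelA i j lam mu z w =
     (let z1 = z $ i; z2 = z $ j; w1 = cnj (w $ i); w2 = cnj (w $ j);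
          D = diag3 ((1 - z1 * w1) * (1 - z2 * w2)) (1 - z2 * w2) (1 - z1 * w1);
          M = vector
            [vector [1, z1, z2],
             vector [w1, of_real (1 / lam $ i + (mu $ 1)\<^sup>2) + z1 * w1, w1 * z2],
             vector [w2, z1 * w2, of_real (1 / lam $ j + (mu $ 2)\<^sup>2) + z2 * w2]];
          c = \<Prod>k\<in>UNIV. (1 - z $ k * cnj (w $ k)) powr
                of_real (- lam $ k - 2 * of_bool (k = i) - 2 * of_bool (k = j))
      in D ** M ** D ** mat c)"

definition is_spaceA ::
  "'n::finite \<Rightarrow> 'n \<Rightarrow> real^'n \<Rightarrow> real^2 \<Rightarrow> (complex^'n \<Rightarrow> complex^3) hilbert \<Rightarrow> bool" where
  "is_spaceA i j lam mu H \<longleftrightarrow>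
     is_rkhs polydisc (kernelA i j lam mu) H \<and> (\<forall>f\<in>vecs H. holo_on f polydisc)"

definition coord_mult :: "'n::finite \<Rightarrow> (complex^'n \<Rightarrow> complex^'m) \<Rightarrow> complex^'n \<Rightarrow> complex^'m" where
  "coord_mult k f = (\<lambda>z. z $ k *s f z)"

end

theory Submission
  imports Defs
begin

text \<open>
  Write \<open>A\<^sub>k = 1 - z\<^sub>k cnj w\<^sub>k\<close> and \<open>S = \<Prod>k. A\<^sub>k powr -\<lambda>\<^sub>k\<close>. After cancelling the powers of
  \<open>A\<^sub>1, A\<^sub>2\<close>, the kernel of the space is
  \<open>K = S (Q P\<^sup>T + diag (0, \<kappa>\<^sub>1 / A\<^sub>1\<^sup>2, \<kappa>\<^sub>2 / A\<^sub>2\<^sup>2))\<close> with \<open>Q = (1, cnj w\<^sub>1 / A\<^sub>1, cnj w\<^sub>2 / A\<^sub>2)\<close>,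
  \<open>P = (1, z\<^sub>1 / A\<^sub>1, z\<^sub>2 / A\<^sub>2)\<close> and \<open>\<kappa>\<^sub>k = 1 / \<lambda>\<^sub>k + \<mu>\<^sub>k\<^sup>2\<close> (lemma \<open>kernelA_nth\<close>). The part with
  \<open>1 / \<lambda>\<^sub>k\<close> in place of \<open>\<kappa>\<^sub>k\<close> is the kernel of the space of jets \<open>(f, \<partial>\<^sub>1f / \<lambda>\<^sub>1, \<partial>\<^sub>2f / \<lambda>\<^sub>2)\<close>, where
  \<open>f\<close> runs through the scalar space with kernel \<open>S\<close>; the rest is \<open>\<mu>\<^sub>k\<^sup>2 S / A\<^sub>k\<^sup>2\<close> in the \<open>k\<close>-th
  derivative slot. A reproducing kernel space is determined by its kernel, so the theorem reduces to
  an identity and an inequality for \<open>K\<close>.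

  The identity is quasi-invariance. For an automorphism \<open>\<psi>\<close> of the polydisc acting on each
  variable separately, \<open>S\<close> is multiplied by powers of the derivatives, and the derivative slots of a
  jet transform by the chain rule. Hence \<open>K z w = J z K (\<psi> z) (\<psi> w) (J w)\<^sup>*\<close> for a triangular
  matrix \<open>J\<close> (lemma \<open>kernelA_quasi_invariant\<close>), and \<open>U f = J \<cdot> (f \<circ> \<psi>)\<close> is unitary
  (lemma \<open>weighted_comp_unitary\<close>). If \<open>g\<close> is the inverse of \<open>\<psi>\<close>, then \<open>U\<close> carries
  multiplication by \<open>g\<^sub>k (z\<^sub>k)\<close> to multiplication by \<open>z\<^sub>k\<close>.

  The inequality is boundedness of multiplication by \<open>z\<^sub>k\<close>, that is, positivity of
  \<open>(C - z\<^sub>k cnj w\<^sub>k) K\<close> for large \<open>C\<close> (lemma \<open>shift_kernelA_pos\<close>). On the scalar factors this is a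
  comparison of consecutive binomial coefficients. Multiplication by \<open>z\<^sub>1\<close> does not preserve jets:
  \<open>z\<^sub>1\<close> times the jet of \<open>f\<close> is the jet of \<open>z\<^sub>1 f\<close> minus \<open>(0, f / \<lambda>\<^sub>1, 0)\<close>. The error has kernel
  \<open>S / \<lambda>\<^sub>1\<^sup>2\<close> in the slot of \<open>\<partial>\<^sub>1\<close>, which a multiple of the summand \<open>\<mu>\<^sub>1\<^sup>2 S / A\<^sub>1\<^sup>2\<close> dominates
  because \<open>\<mu>\<^sub>1 > 0\<close> (lemma \<open>schur_factor_shift_jet\<close>).

  The two facts together give the spectrum and the functional calculus without further estimates.
  Multiplication by \<open>g\<^sub>k (z\<^sub>k)\<close> is unitarily equivalent to multiplication by \<open>z\<^sub>k\<close>, so it is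
  bounded, and \<open>1 / (1 - cnj a z)\<close> is an affine function of the automorphism
  \<open>(z - a) / (1 - cnj a z)\<close>. Thus multiplication by \<open>1 / (1 - cnj a z\<^sub>k)\<close> is bounded whenever
  \<open>\<bar>a\<bar> < 1\<close> (lemma \<open>bounded_resolvent\<close>), which inverts the denominator of \<open>g\<^sub>k\<close> and also
  \<open>z\<^sub>k - \<zeta>\<^sub>k\<close> for \<open>\<bar>\<zeta>\<^sub>k\<bar> > 1\<close>. One invertible member of a commuting tuple makes the Koszul complex
  contractible (lemma \<open>koszul_exact_if_invertible\<close>), so the joint spectrum lies in the closed
  polydisc.
\<close>

\<comment> \<open>Indexing of vectors and coefficients of power series share the symbol $; with both active, the
  number of parse trees doubles with each index.\<close>
no_notation fps_nth (infixl "$" 75)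

section \<open>Hilbert spaces with explicit carrier\<close>

context chilbert_space
begin

lemma scl_zero [simp]: "x \<in> vecs H \<Longrightarrow> scl H 0 x = 0"
  using scl_add_left[of x 0 0] by simp

lemma scl_minus_one: "x \<in> vecs H \<Longrightarrow> scl H (- 1) x = - x"
  using scl_add_left[of x "- 1" 1] by (simp add: scl_one eq_neg_iff_add_eq_0)

lemma minus_mem: "x \<in> vecs H \<Longrightarrow> - x \<in> vecs H"
  using scl_mem[of x "- 1"] by (simp add: scl_minus_one)

lemma diff_mem: "x \<in> vecs H \<Longrightarrow> y \<in> vecs H \<Longrightarrow> x - y \<in> vecs H"
  using add_mem[of x "- y"] by (simp add: minus_mem)

lemma scl_zero_right [simp]: "scl H a 0 = 0"
  using scl_add_right[of 0 0 a] zero_mem by simp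

lemma sum_mem: "(\<And>x. x \<in> F \<Longrightarrow> h x \<in> vecs H) \<Longrightarrow> sum h F \<in> vecs H"
  by (induction F rule: infinite_finite_induct) (auto intro: zero_mem add_mem)

lemma scl_sum:
  "(\<And>x. x \<in> F \<Longrightarrow> h x \<in> vecs H) \<Longrightarrow> scl H a (sum h F) = (\<Sum>x\<in>F. scl H a (h x))"
  by (induction F rule: infinite_finite_induct) (auto simp: scl_add_right sum_mem)

lemma ip_zero_left [simp]: "y \<in> vecs H \<Longrightarrow> ip H 0 y = 0"
  using ip_add_left[of 0 0 y] zero_mem by simp

lemma ip_zero_right [simp]: "y \<in> vecs H \<Longrightarrow> ip H y 0 = 0"
  using ip_commute[of 0 y] zero_mem by simp

lemma ip_minus_left: "x \<in> vecs H \<Longrightarrow> y \<in> vecs H \<Longrightarrow> ip H (- x) y = - ip H x y"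
  using ip_scl_left[of x y "- 1"] by (simp add: scl_minus_one)

lemma ip_diff_left:
  "\<lbrakk>x \<in> vecs H; y \<in> vecs H; z \<in> vecs H\<rbrakk> \<Longrightarrow> ip H (x - y) z = ip H x z - ip H y z"
  using ip_add_left[of x "- y" z] by (simp add: minus_mem ip_minus_left)

lemma ip_add_right:
  assumes "x \<in> vecs H" "y \<in> vecs H" "z \<in> vecs H"
  shows "ip H z (x + y) = ip H z x + ip H z y"
  using ip_commute[of "x + y" z] ip_commute[of x z] ip_commute[of y z] assms
  by (simp add: add_mem ip_add_left)

lemma ip_scl_right:
  assumes "x \<in> vecs H" "y \<in> vecs H" shows "ip H x (scl H a y) = cnj a * ip H x y"
  using ip_commute[of "scl H a y" x] ip_commute[of y x] assms by (simp add: scl_mem ip_scl_left)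

lemma ip_diff_right:
  assumes "x \<in> vecs H" "y \<in> vecs H" "z \<in> vecs H"
  shows "ip H z (x - y) = ip H z x - ip H z y"
  using ip_add_right[of "x - y" y z] assms by (simp add: diff_mem)

lemma ip_sum_left:
  "(\<And>x. x \<in> F \<Longrightarrow> h x \<in> vecs H) \<Longrightarrow> y \<in> vecs H \<Longrightarrow> ip H (sum h F) y = (\<Sum>x\<in>F. ip H (h x) y)"
  by (induction F rule: infinite_finite_induct) (auto simp: ip_add_left sum_mem)

lemma ip_sum_right:
  "(\<And>x. x \<in> F \<Longrightarrow> h x \<in> vecs H) \<Longrightarrow> y \<in> vecs H \<Longrightarrow> ip H y (sum h F) = (\<Sum>x\<in>F. ip H y (h x))"
  by (induction F rule: infinite_finite_induct) (auto simp: ip_add_right sum_mem)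

lemma ip_self_ge_0: "x \<in> vecs H \<Longrightarrow> Re (ip H x x) \<ge> 0"
  using ip_pos[of x] by (cases "x = 0") auto

lemma hnorm_ge_0: "x \<in> vecs H \<Longrightarrow> hnorm H x \<ge> 0"
  by (simp add: hnorm_def ip_self_ge_0)

lemma hnorm_sq: "x \<in> vecs H \<Longrightarrow> (hnorm H x)\<^sup>2 = Re (ip H x x)"
  by (simp add: hnorm_def ip_self_ge_0)

lemma hnorm_eq_0: "x \<in> vecs H \<Longrightarrow> hnorm H x = 0 \<longleftrightarrow> x = 0"
  using ip_pos[of x] by (force simp: hnorm_def zero_mem)

lemma Re_ip_commute: "x \<in> vecs H \<Longrightarrow> y \<in> vecs H \<Longrightarrow> Re (ip H y x) = Re (ip H x y)"
  using ip_commute[of x y] by simp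

lemma hnorm_add_sq:
  assumes "x \<in> vecs H" "y \<in> vecs H"
  shows "(hnorm H (x + y))\<^sup>2 = (hnorm H x)\<^sup>2 + 2 * Re (ip H x y) + (hnorm H y)\<^sup>2"
  using assms Re_ip_commute[of x y] by (simp add: hnorm_sq add_mem ip_add_left ip_add_right)

lemma hnorm_scl_sq: "x \<in> vecs H \<Longrightarrow> (hnorm H (scl H a x))\<^sup>2 = (cmod a)\<^sup>2 * (hnorm H x)\<^sup>2"
  by (simp add: hnorm_sq scl_mem ip_scl_left ip_scl_right cmod_power2
      power2_eq_square[of "Re a"] power2_eq_square[of "Im a"] flip: mult.assoc)

lemma hnorm_scl: "x \<in> vecs H \<Longrightarrow> hnorm H (scl H a x) = cmod a * hnorm H x"
  by (rule power2_eq_imp_eq) (auto simp: hnorm_scl_sq power_mult_distrib hnorm_ge_0 scl_mem)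

lemma hnorm_minus: "x \<in> vecs H \<Longrightarrow> hnorm H (- x) = hnorm H x"
  using hnorm_scl[of x "- 1"] by (simp add: scl_minus_one)

lemma hnorm_diff_sq:
  assumes "x \<in> vecs H" "y \<in> vecs H"
  shows "(hnorm H (x - y))\<^sup>2 = (hnorm H x)\<^sup>2 - 2 * Re (ip H x y) + (hnorm H y)\<^sup>2"
  using assms Re_ip_commute[of x y] by (simp add: hnorm_sq diff_mem ip_diff_left ip_diff_right)

lemma Re_ip_le:
  assumes x: "x \<in> vecs H" and y: "y \<in> vecs H"
  shows "Re (ip H x y) \<le> hnorm H x * hnorm H y"
proof (cases "x = 0 \<or> y = 0")
  case True
  then show ?thesis using assms by (auto simp: hnorm_ge_0)
next
  case False
  define a b where "a = hnorm H x" and "b = hnorm H y"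
  have a: "a > 0" and b: "b > 0"
    using False x y hnorm_ge_0[OF x] hnorm_ge_0[OF y] hnorm_eq_0[OF x] hnorm_eq_0[OF y]
    unfolding a_def b_def by linarith+
  have "0 \<le> (hnorm H (scl H b x - scl H a y))\<^sup>2" by simp
  also have "\<dots> = b\<^sup>2 * a\<^sup>2 - 2 * (a * b * Re (ip H x y)) + a\<^sup>2 * b\<^sup>2"
    using x y a b
    by (simp add: hnorm_diff_sq scl_mem hnorm_scl_sq ip_scl_left ip_scl_right
        a_def[symmetric] b_def[symmetric])
  finally have "(a * b) * Re (ip H x y) \<le> (a * b) * (a * b)"
    by (simp add: power2_eq_square algebra_simps)
  then show ?thesis using a b by (simp add: a_def[symmetric] b_def[symmetric])
qed

lemma abs_Re_ip_le:
  assumes "x \<in> vecs H" "y \<in> vecs H" shows "\<bar>Re (ip H x y)\<bar> \<le> hnorm H x * hnorm H y"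
  using Re_ip_le[of x y] Re_ip_le[of "- x" y] assms
  by (simp add: minus_mem ip_minus_left hnorm_minus abs_le_iff)

lemma hnorm_triangle:
  assumes "x \<in> vecs H" "y \<in> vecs H" shows "hnorm H (x + y) \<le> hnorm H x + hnorm H y"
proof (rule power2_le_imp_le)
  show "(hnorm H (x + y))\<^sup>2 \<le> (hnorm H x + hnorm H y)\<^sup>2"
    using hnorm_add_sq[OF assms] Re_ip_le[OF assms] by (simp add: power2_sum)
qed (use assms in \<open>auto simp: hnorm_ge_0\<close>)

lemma Re_ip_tendsto:
  assumes X: "\<And>k. X k \<in> vecs H" and x: "x \<in> vecs H" and y: "y \<in> vecs H"
    and lim: "(\<lambda>k::nat. hnorm H (X k - x)) \<longlonglongrightarrow> 0"
  shows "(\<lambda>k. Re (ip H (X k) y)) \<longlonglongrightarrow> Re (ip H x y)"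
proof (rule LIM_zero_cancel, rule Lim_null_comparison)
  show "\<forall>\<^sub>F k in sequentially. norm (Re (ip H (X k) y) - Re (ip H x y)) \<le> hnorm H (X k - x) * hnorm H y"
    using abs_Re_ip_le[of "X _ - x" y] X x y by (auto simp: ip_diff_left diff_mem)
  show "(\<lambda>k. hnorm H (X k - x) * hnorm H y) \<longlonglongrightarrow> 0"
    using tendsto_mult_right[OF lim] by simp
qed

lemma hnorm_sq_tendsto:
  assumes X: "\<And>k. X k \<in> vecs H" and x: "x \<in> vecs H"
    and lim: "(\<lambda>k::nat. hnorm H (X k - x)) \<longlonglongrightarrow> 0"
  shows "(\<lambda>k. (hnorm H (X k))\<^sup>2) \<longlonglongrightarrow> (hnorm H x)\<^sup>2"
proof -
  have eq: "(hnorm H (X k))\<^sup>2 = (hnorm H (X k - x))\<^sup>2 + 2 * Re (ip H (X k) x) - (hnorm H x)\<^sup>2" for k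
    using hnorm_diff_sq[OF X[of k] x] by simp
  have "(\<lambda>k. (hnorm H (X k - x))\<^sup>2 + 2 * Re (ip H (X k) x) - (hnorm H x)\<^sup>2)
      \<longlonglongrightarrow> 0\<^sup>2 + 2 * Re (ip H x x) - (hnorm H x)\<^sup>2"
    by (intro tendsto_intros lim Re_ip_tendsto X x)
  then show ?thesis unfolding eq[symmetric] by (simp add: hnorm_sq[OF x])
qed

text \<open>
  A linear relation \<open>P\<close> with \<open>\<parallel>v\<parallel> \<le> C \<parallel>u\<parallel>\<close> is the graph of a bounded operator on some subspace,
  and the vector found here is the adjoint of that operator applied to \<open>f\<close>. It is obtained by
  minimising \<open>\<parallel>u\<parallel>\<^sup>2 - 2 Re \<langle>v, f\<rangle>\<close> over \<open>P\<close>: by the parallelogram law a minimising sequence is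
  Cauchy, and the vanishing first variation at its limit is the required equation.
\<close>

lemma adjoint_of_bounded_relation:
  assumes P: "P \<subseteq> vecs H \<times> vecs H" "(0, 0) \<in> P"
    and P_add: "\<And>u v u' v'. (u, v) \<in> P \<Longrightarrow> (u', v') \<in> P \<Longrightarrow> (u + u', v + v') \<in> P"
    and P_scl: "\<And>a u v. (u, v) \<in> P \<Longrightarrow> (scl H a u, scl H a v) \<in> P"
    and bound: "\<And>u v. (u, v) \<in> P \<Longrightarrow> hnorm H v \<le> C * hnorm H u"
    and C: "C \<ge> 0" and f: "f \<in> vecs H"
  shows "\<exists>g\<in>vecs H. (\<forall>(u, v)\<in>P. ip H g u = ip H f v) \<and> hnorm H g \<le> C * hnorm H f"
proof -
  define \<Phi> where "\<Phi> = (\<lambda>(u, v). (hnorm H u)\<^sup>2 - 2 * Re (ip H v f))"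
  have mem: "u \<in> vecs H" "v \<in> vecs H" if "(u, v) \<in> P" for u v using that P(1) by auto
  \<comment> \<open>complete the square after Cauchy-Schwarz\<close>
  have low: "- (C * hnorm H f)\<^sup>2 \<le> \<Phi> w" if "w \<in> P" for w
  proof -
    obtain u v where w: "w = (u, v)" by (cases w)
    have uv: "(u, v) \<in> P" using that w by simp
    have "Re (ip H v f) \<le> hnorm H v * hnorm H f" using mem[OF uv] f by (simp add: Re_ip_le)
    also have "\<dots> \<le> C * hnorm H u * hnorm H f"
      using bound[OF uv] hnorm_ge_0[OF f] by (rule mult_right_mono)
    finally have "2 * Re (ip H v f) \<le> 2 * (hnorm H u * (C * hnorm H f))" by (simp add: mult_ac)
    moreover have "2 * (hnorm H u * (C * hnorm H f)) \<le> (hnorm H u)\<^sup>2 + (C * hnorm H f)\<^sup>2"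
      using sum_squares_bound[of "hnorm H u" "C * hnorm H f"] by (simp add: mult_ac)
    ultimately show ?thesis by (simp add: w \<Phi>_def)
  qed
  define m where "m = Inf (\<Phi> ` P)"
  have bdd: "bdd_below (\<Phi> ` P)" using low by (auto intro!: bdd_belowI)
  have ge_m: "m \<le> \<Phi> w" if "w \<in> P" for w
    unfolding m_def using that bdd by (simp add: cInf_lower)
  have "\<exists>w\<in>P. \<Phi> w < m + 1 / real (Suc k)" for k
  proof -
    have "Inf (\<Phi> ` P) < m + 1 / real (Suc k)" by (simp add: m_def)
    then show ?thesis using P(2) bdd by (subst (asm) cInf_less_iff) auto
  qed
  then obtain W where W: "\<And>k. W k \<in> P" "\<And>k. \<Phi> (W k) < m + 1 / real (Suc k)" by metis
  define U V where "U = fst \<circ> W" and "V = snd \<circ> W"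
  have UV: "(U k, V k) \<in> P" for k using W(1)[of k] by (simp add: U_def V_def)
  have UH: "U k \<in> vecs H" for k using mem(1)[OF UV] .
  have VH: "V k \<in> vecs H" for k using mem(2)[OF UV] .
  have \<Phi>UV: "\<Phi> (U k, V k) < m + 1 / real (Suc k)" for k using W(2)[of k] by (simp add: U_def V_def)
  \<comment> \<open>the midpoint of two members of \<open>P\<close> has \<open>\<Phi> \<ge> m\<close>\<close>
  have para: "(hnorm H (U j - U k))\<^sup>2 \<le> 2 * (1 / real (Suc j) + 1 / real (Suc k))" for j k
  proof -
    have "(U j + U k, V j + V k) \<in> P" by (intro P_add UV)
    then have "(scl H (1/2) (U j + U k), scl H (1/2) (V j + V k)) \<in> P" by (rule P_scl)
    from ge_m[OF this]
    have "4 * m \<le> (hnorm H (U j))\<^sup>2 + 2 * Re (ip H (U j) (U k)) + (hnorm H (U k))\<^sup>2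
        - 4 * Re (ip H (V j) f) - 4 * Re (ip H (V k) f)"
      using UH VH f
      by (simp add: \<Phi>_def hnorm_scl_sq add_mem scl_mem ip_scl_left ip_add_left hnorm_add_sq
          power_divide divide_simps algebra_simps)
    moreover have "(hnorm H (U j - U k))\<^sup>2
        = (hnorm H (U j))\<^sup>2 - 2 * Re (ip H (U j) (U k)) + (hnorm H (U k))\<^sup>2"
      using UH by (simp add: hnorm_diff_sq)
    ultimately show ?thesis using \<Phi>UV[of j] \<Phi>UV[of k] unfolding \<Phi>_def by simp
  qed
  have "\<exists>N. \<forall>j\<ge>N. \<forall>k\<ge>N. hnorm H (U j - U k) < e" if "e > 0" for e
  proof -
    obtain N where N: "4 / e\<^sup>2 < real N" using reals_Archimedean2 by blast
    have "hnorm H (U j - U k) < e" if "j \<ge> N" "k \<ge> N" for j k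
    proof (rule power2_less_imp_less)
      have N0: "real N > 0" using N \<open>e > 0\<close> by (smt (verit) divide_pos_pos zero_less_power)
      have "1 / real (Suc j) \<le> 1 / real N" "1 / real (Suc k) \<le> 1 / real N"
        using that N0 by (auto intro!: divide_left_mono)
      then have "2 * (1 / real (Suc j) + 1 / real (Suc k)) \<le> 2 * (1 / real N + 1 / real N)"
        by (intro mult_left_mono add_mono) auto
      then have "(hnorm H (U j - U k))\<^sup>2 \<le> 4 / real N"
        using order_trans[OF para[of j k]] by simp
      also have "\<dots> < e\<^sup>2" using N N0 \<open>e > 0\<close> by (simp add: field_simps)
      finally show "(hnorm H (U j - U k))\<^sup>2 < e\<^sup>2" .
    qed (use \<open>e > 0\<close> in simp)
    then show ?thesis by blast
  qed
  then obtain g where g: "g \<in> vecs H" and lim: "(\<lambda>k. hnorm H (U k - g)) \<longlonglongrightarrow> 0"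
    using complete[of U] UH by blast
  have \<Phi>lim: "(\<lambda>k. \<Phi> (U k, V k)) \<longlonglongrightarrow> m"
  proof (rule tendsto_sandwich[where f = "\<lambda>_. m"])
    show "(\<lambda>k. m + 1 / real (Suc k)) \<longlonglongrightarrow> m"
      using tendsto_add[OF tendsto_const LIMSEQ_inverse_real_of_nat, of m]
      by (simp add: inverse_eq_divide)
  qed (auto intro!: always_eventually ge_m UV less_imp_le[OF \<Phi>UV] simp del: of_nat_Suc)
  \<comment> \<open>first variation of \<open>\<Phi>\<close> at the limit \<open>g\<close> in the direction \<open>(u, v)\<close>\<close>
  have Re_eq: "Re (ip H g u) = Re (ip H f v)" if uv: "(u, v) \<in> P" for u v
  proof -
    define b where "b = 2 * (Re (ip H g u) - Re (ip H f v))"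
    have var: "0 \<le> t * b + t\<^sup>2 * (hnorm H u)\<^sup>2" for t :: real
    proof -
      have "m \<le> \<Phi> (U k, V k) + 2 * t * (Re (ip H (U k) u) - Re (ip H f v)) + t\<^sup>2 * (hnorm H u)\<^sup>2" for k
        using ge_m[OF P_add[OF UV P_scl[OF uv, of "of_real t"]], of k] UH VH mem[OF uv] f
        by (simp add: \<Phi>_def hnorm_add_sq scl_mem hnorm_scl_sq ip_scl_right ip_add_left
            ip_scl_left Re_ip_commute[of f v] algebra_simps)
      then have "m \<le> m + 2 * t * (Re (ip H g u) - Re (ip H f v)) + t\<^sup>2 * (hnorm H u)\<^sup>2"
        by (intro LIMSEQ_le_const[where X = "\<lambda>k. \<Phi> (U k, V k)
              + 2 * t * (Re (ip H (U k) u) - Re (ip H f v)) + t\<^sup>2 * (hnorm H u)\<^sup>2"]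
            tendsto_intros \<Phi>lim Re_ip_tendsto UH g mem[OF uv] lim) blast
      then show ?thesis by (simp add: b_def algebra_simps)
    qed
    have "b = 0"
    proof (rule ccontr)
      assume b: "b \<noteq> 0"
      define s where "s = (hnorm H u)\<^sup>2 + 1"
      have s: "s > 0" by (simp add: s_def add_nonneg_pos)
      have "0 \<le> - (b / s) * b + (b / s)\<^sup>2 * (s - 1)" using var[of "- b / s"] by (simp add: s_def)
      also have "\<dots> = - (b / s)\<^sup>2" using s by (simp add: field_simps power2_eq_square)
      finally show False using b s by simp
    qed
    then show ?thesis by (simp add: b_def)
  qed
  have eq: "ip H g u = ip H f v" if uv: "(u, v) \<in> P" for u v
    \<comment> \<open>the imaginary part comes from the pair \<open>(\<i> u, \<i> v)\<close>\<close>
    using Re_eq[OF uv] Re_eq[OF P_scl[OF uv, of \<i>]] mem[OF uv] f g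
    by (simp add: ip_scl_right complex_eq_iff)
  have "(hnorm H g)\<^sup>2 \<le> (C * hnorm H f) * hnorm H g"
  proof (rule LIMSEQ_le)
    show "(\<lambda>k. Re (ip H (U k) g)) \<longlonglongrightarrow> (hnorm H g)\<^sup>2"
      using Re_ip_tendsto[OF UH g g lim] by (simp add: hnorm_sq[OF g])
    have "(\<lambda>k. sqrt ((hnorm H (U k))\<^sup>2)) \<longlonglongrightarrow> sqrt ((hnorm H g)\<^sup>2)"
      by (intro tendsto_real_sqrt hnorm_sq_tendsto UH g lim)
    then have "(\<lambda>k. hnorm H (U k)) \<longlonglongrightarrow> hnorm H g"
      using UH g by (simp add: hnorm_ge_0)
    then show "(\<lambda>k. C * hnorm H f * hnorm H (U k)) \<longlonglongrightarrow> C * hnorm H f * hnorm H g"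
      by (rule tendsto_mult_left)
    have "Re (ip H (U k) g) \<le> C * hnorm H f * hnorm H (U k)" for k
    proof -
      have "Re (ip H (U k) g) = Re (ip H f (V k))"
        using eq[OF UV[of k]] Re_ip_commute[OF g UH[of k]] by simp
      also have "\<dots> \<le> hnorm H f * hnorm H (V k)" by (intro Re_ip_le f VH)
      also have "\<dots> \<le> hnorm H f * (C * hnorm H (U k))"
        by (intro mult_left_mono bound UV hnorm_ge_0 f)
      finally show ?thesis by (simp add: mult_ac)
    qed
    then show "\<exists>N. \<forall>k\<ge>N. Re (ip H (U k) g) \<le> C * hnorm H f * hnorm H (U k)" by blast
  qed
  then have "hnorm H g \<le> C * hnorm H f"
    using hnorm_ge_0[OF g] C hnorm_ge_0[OF f]
    by (cases "hnorm H g = 0") (auto simp: power2_eq_square)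
  with eq g show ?thesis by blast
qed

text \<open>Polarisation.\<close>

lemma isometry_ip:
  assumes T: "linear_operator H T" and iso: "\<And>x. x \<in> vecs H \<Longrightarrow> hnorm H (T x) = hnorm H x"
    and xy: "x \<in> vecs H" "y \<in> vecs H"
  shows "ip H (T x) (T y) = ip H x y"
proof -
  have mem: "T x \<in> vecs H" if "x \<in> vecs H" for x using T that by (auto simp: linear_operator_def)
  have Re: "Re (ip H (T x) (T y)) = Re (ip H x y)" if "x \<in> vecs H" "y \<in> vecs H" for x y
  proof -
    have "T (x + y) = T x + T y" using T that by (auto simp: linear_operator_def)
    then have "(hnorm H (T x + T y))\<^sup>2 = (hnorm H (x + y))\<^sup>2"
      using iso[OF add_mem[OF that]] by simp
    then show ?thesis using that by (simp add: hnorm_add_sq mem iso)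
  qed
  have "T (scl H \<i> y) = scl H \<i> (T y)" using T xy by (auto simp: linear_operator_def)
  then show ?thesis
    using Re[OF xy] Re[OF xy(1) scl_mem[OF xy(2), of \<i>]] xy
    by (simp add: ip_scl_right mem complex_eq_iff)
qed

lemma unitary_operatorI:
  assumes T: "linear_operator H T" and iso: "\<And>x. x \<in> vecs H \<Longrightarrow> hnorm H (T x) = hnorm H x"
    and R: "\<And>x. x \<in> vecs H \<Longrightarrow> R x \<in> vecs H"
      "\<And>x. x \<in> vecs H \<Longrightarrow> R (T x) = x" "\<And>x. x \<in> vecs H \<Longrightarrow> T (R x) = x"
  shows "unitary_operator H T"
proof -
  have "T \<in> vecs H \<rightarrow> vecs H" using T by (simp add: linear_operator_def)
  then have "bij_betw T (vecs H) (vecs H)"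
    using R by (intro bij_betwI[where g = R]) auto
  then show ?thesis using T isometry_ip[OF T iso] by (simp add: unitary_operator_def)
qed

lemma unitary_hnorm:
  "unitary_operator H U \<Longrightarrow> x \<in> vecs H \<Longrightarrow> hnorm H (U x) = hnorm H x"
  by (simp add: unitary_operator_def hnorm_def)

lemma bounded_operatorE:
  assumes "bounded_operator H T"
  obtains C where "C \<ge> 0" "\<And>x. x \<in> vecs H \<Longrightarrow> hnorm H (T x) \<le> C * hnorm H x"
proof -
  obtain C where C: "\<And>x. x \<in> vecs H \<Longrightarrow> hnorm H (T x) \<le> C * hnorm H x"
    using assms by (auto simp: bounded_operator_def)
  have "hnorm H (T x) \<le> \<bar>C\<bar> * hnorm H x" if "x \<in> vecs H" for x
    using C[OF that] mult_right_mono[OF abs_ge_self hnorm_ge_0[OF that], of C] by linarith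
  then show ?thesis using that[of "\<bar>C\<bar>"] by simp
qed

lemma bounded_operator_mem: "bounded_operator H T \<Longrightarrow> x \<in> vecs H \<Longrightarrow> T x \<in> vecs H"
  by (auto simp: bounded_operator_def linear_operator_def)

lemma bounded_operator_id: "bounded_operator H (\<lambda>x. x)"
  unfolding bounded_operator_def linear_operator_def by (auto intro: exI[of _ 1])

lemma bounded_operator_unitary: "unitary_operator H U \<Longrightarrow> bounded_operator H U"
  unfolding bounded_operator_def using unitary_hnorm[of U]
  by (auto simp: unitary_operator_def intro!: exI[of _ 1])

lemma bounded_operator_compose:
  assumes S: "bounded_operator H S" and T: "bounded_operator H T"
  shows "bounded_operator H (\<lambda>x. S (T x))"
proof -
  obtain C where C: "C \<ge> 0" "\<And>x. x \<in> vecs H \<Longrightarrow> hnorm H (S x) \<le> C * hnorm H x"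
    using bounded_operatorE[OF S] by blast
  obtain D where D: "D \<ge> 0" "\<And>x. x \<in> vecs H \<Longrightarrow> hnorm H (T x) \<le> D * hnorm H x"
    using bounded_operatorE[OF T] by blast
  have "hnorm H (S (T x)) \<le> C * D * hnorm H x" if "x \<in> vecs H" for x
    using C(2)[OF bounded_operator_mem[OF T that]] mult_left_mono[OF D(2)[OF that] C(1)]
    by (simp add: mult.assoc)
  moreover have "linear_operator H (\<lambda>x. S (T x))"
    using S T by (simp add: bounded_operator_def linear_operator_def Pi_iff)
  ultimately show ?thesis by (auto simp: bounded_operator_def)
qed

lemma bounded_operator_scl:
  assumes "bounded_operator H T" shows "bounded_operator H (\<lambda>x. scl H a (T x))"
proof -
  obtain C where C: "C \<ge> 0" "\<And>x. x \<in> vecs H \<Longrightarrow> hnorm H (T x) \<le> C * hnorm H x"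
    using bounded_operatorE[OF assms] by blast
  have mem: "T x \<in> vecs H" if "x \<in> vecs H" for x using bounded_operator_mem[OF assms that] .
  have "hnorm H (scl H a (T x)) \<le> (cmod a * C) * hnorm H x" if "x \<in> vecs H" for x
    using mult_left_mono[OF C(2)[OF that] norm_ge_zero[of a]]
    by (simp add: hnorm_scl mem that mult.assoc)
  moreover have "linear_operator H (\<lambda>x. scl H a (T x))"
    using assms mem by (auto simp: bounded_operator_def linear_operator_def scl_mem scl_add_right
        scl_scl mult.commute)
  ultimately show ?thesis by (auto simp: bounded_operator_def)
qed

lemma bounded_operator_add:
  assumes S: "bounded_operator H S" and T: "bounded_operator H T"
  shows "bounded_operator H (\<lambda>x. S x + T x)"
proof -
  obtain C where C: "C \<ge> 0" "\<And>x. x \<in> vecs H \<Longrightarrow> hnorm H (S x) \<le> C * hnorm H x"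
    using bounded_operatorE[OF S] by blast
  obtain D where D: "D \<ge> 0" "\<And>x. x \<in> vecs H \<Longrightarrow> hnorm H (T x) \<le> D * hnorm H x"
    using bounded_operatorE[OF T] by blast
  have mem: "S x \<in> vecs H" "T x \<in> vecs H" if "x \<in> vecs H" for x
    using bounded_operator_mem[OF S that] bounded_operator_mem[OF T that] .
  have "hnorm H (S x + T x) \<le> (C + D) * hnorm H x" if "x \<in> vecs H" for x
    using hnorm_triangle[OF mem[OF that]] C(2)[OF that] D(2)[OF that] by (simp add: distrib_right)
  moreover have "linear_operator H (\<lambda>x. S x + T x)"
    using S T mem by (auto simp: bounded_operator_def linear_operator_def add_mem scl_add_right)
  ultimately show ?thesis by (auto simp: bounded_operator_def)
qed

end

section \<open>Positive kernels and Schur products\<close>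

text \<open>
  Only the real part is tested, as for a Hermitian kernel the sums are real. Scalar kernels on
  \<open>\<Omega> \<times> 'm\<close> will serve instead of matrix-valued ones on \<open>\<Omega>\<close>: the entry with indices \<open>p\<close>, \<open>q\<close> at
  \<open>z\<close>, \<open>w\<close> is the value at the points \<open>(z, p)\<close> and \<open>(w, q)\<close>.
\<close>

definition pos_kernel :: "'b set \<Rightarrow> ('b \<Rightarrow> 'b \<Rightarrow> complex) \<Rightarrow> bool" where
  "pos_kernel Y k \<longleftrightarrow>
     (\<forall>F c. finite F \<longrightarrow> F \<subseteq> Y \<longrightarrow> 0 \<le> Re (\<Sum>x\<in>F. \<Sum>y\<in>F. c x * cnj (c y) * k x y))"

text \<open>
  By the Schur product theorem every positive kernel multiplies positive kernels to positive kernels.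
  Taking this property as the notion of positivity spares its proof: it is evident for the rank one
  kernels \<open>f x cnj (f y)\<close>, it is closed under products, sums and convergent series, and it implies
  positivity since the constant \<open>1\<close> is positive.
\<close>

definition schur_factor :: "'b set \<Rightarrow> ('b \<Rightarrow> 'b \<Rightarrow> complex) \<Rightarrow> bool" where
  "schur_factor Y s \<longleftrightarrow> (\<forall>k. pos_kernel Y k \<longrightarrow> pos_kernel Y (\<lambda>x y. s x y * k x y))"

lemma pos_kernel_cong:
  assumes "pos_kernel Y k" "\<And>x y. x \<in> Y \<Longrightarrow> y \<in> Y \<Longrightarrow> k' x y = k x y"
  shows "pos_kernel Y k'"
proof -
  have "(\<Sum>x\<in>F. \<Sum>y\<in>F. c x * cnj (c y) * k' x y) = (\<Sum>x\<in>F. \<Sum>y\<in>F. c x * cnj (c y) * k x y)"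
    if "F \<subseteq> Y" for F c
    using that assms(2) by (intro sum.cong refl) (auto simp: subset_iff)
  with assms(1) show ?thesis by (simp add: pos_kernel_def)
qed

lemma pos_kernel_add:
  assumes "pos_kernel Y k" "pos_kernel Y l" shows "pos_kernel Y (\<lambda>x y. k x y + l x y)"
  using assms by (simp add: pos_kernel_def distrib_left sum.distrib)

lemma pos_kernel_sums:
  assumes k: "\<And>m. pos_kernel Y (k m)"
    and lim: "\<And>x y. x \<in> Y \<Longrightarrow> y \<in> Y \<Longrightarrow> (\<lambda>m. k m x y) sums l x y"
  shows "pos_kernel Y l"
  unfolding pos_kernel_def
proof (intro allI impI)
  fix F and c :: "'a \<Rightarrow> complex" assume F: "finite F" "F \<subseteq> Y"
  have "(\<lambda>m. Re (\<Sum>x\<in>F. \<Sum>y\<in>F. c x * cnj (c y) * k m x y)) sums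
      Re (\<Sum>x\<in>F. \<Sum>y\<in>F. c x * cnj (c y) * l x y)"
    using F by (intro sums_Re sums_sum sums_mult lim) auto
  then show "0 \<le> Re (\<Sum>x\<in>F. \<Sum>y\<in>F. c x * cnj (c y) * l x y)"
  proof (rule sums_le[OF _ sums_zero, rotated])
    show "0 \<le> Re (\<Sum>x\<in>F. \<Sum>y\<in>F. c x * cnj (c y) * k m x y)" for m
      using k[of m] F unfolding pos_kernel_def by blast
  qed
qed

lemma pos_kernel_one: "pos_kernel Y (\<lambda>x y. 1)"
proof -
  have "(\<Sum>x\<in>F. \<Sum>y\<in>F. c x * cnj (c y) * 1) = of_real ((cmod (\<Sum>x\<in>F. c x))\<^sup>2)"
    for F and c :: "'a \<Rightarrow> complex"
  proof -
    have "(\<Sum>x\<in>F. \<Sum>y\<in>F. c x * cnj (c y) * 1) = (\<Sum>x\<in>F. c x) * cnj (\<Sum>x\<in>F. c x)"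
      by (simp add: sum_product)
    then show ?thesis by (simp only: complex_norm_square)
  qed
  then show ?thesis by (simp only: pos_kernel_def Re_complex_of_real) simp
qed

lemma schur_factor_imp_pos_kernel: "schur_factor Y s \<Longrightarrow> pos_kernel Y s"
  unfolding schur_factor_def using pos_kernel_one[of Y]
  by (drule_tac x = "\<lambda>x y. 1" in spec) simp

lemma schur_factor_cong:
  assumes "schur_factor Y s" "\<And>x y. x \<in> Y \<Longrightarrow> y \<in> Y \<Longrightarrow> s' x y = s x y"
  shows "schur_factor Y s'"
  unfolding schur_factor_def
proof (intro allI impI)
  fix k assume "pos_kernel Y k"
  then have "pos_kernel Y (\<lambda>x y. s x y * k x y)"
    using assms(1) by (simp add: schur_factor_def)
  then show "pos_kernel Y (\<lambda>x y. s' x y * k x y)"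
    by (rule pos_kernel_cong) (simp add: assms(2))
qed

lemma schur_factor_add:
  assumes "schur_factor Y s" "schur_factor Y t"
  shows "schur_factor Y (\<lambda>x y. s x y + t x y)"
  using assms unfolding schur_factor_def by (simp add: distrib_right pos_kernel_add)

lemma schur_factor_mult:
  assumes "schur_factor Y s" "schur_factor Y t"
  shows "schur_factor Y (\<lambda>x y. s x y * t x y)"
  using assms unfolding schur_factor_def by (simp add: mult.assoc)

lemma schur_factor_sums:
  assumes "\<And>m. schur_factor Y (s m)"
    and lim: "\<And>x y. x \<in> Y \<Longrightarrow> y \<in> Y \<Longrightarrow> (\<lambda>m. s m x y) sums l x y"
  shows "schur_factor Y l"
  unfolding schur_factor_def
proof (intro allI impI)
  fix k assume k: "pos_kernel Y k"
  show "pos_kernel Y (\<lambda>x y. l x y * k x y)"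
  proof (rule pos_kernel_sums)
    show "pos_kernel Y (\<lambda>x y. s m x y * k x y)" for m
      using assms(1)[of m] k by (simp add: schur_factor_def)
    show "(\<lambda>m. s m x y * k x y) sums (l x y * k x y)" if "x \<in> Y" "y \<in> Y" for x y
      using lim[OF that] by (rule sums_mult2)
  qed
qed

lemma schur_factor_rank_one: "schur_factor Y (\<lambda>x y. f x * cnj (f y))"
  unfolding schur_factor_def pos_kernel_def
proof (intro allI impI)
  fix k F and c :: "'a \<Rightarrow> complex"
  assume *: "\<forall>F c. finite F \<longrightarrow> F \<subseteq> Y \<longrightarrow> 0 \<le> Re (\<Sum>x\<in>F. \<Sum>y\<in>F. c x * cnj (c y) * k x y)"
    "finite F" "F \<subseteq> Y"
  from *(1)[rule_format, OF *(2,3), of "\<lambda>x. c x * f x"]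
  show "0 \<le> Re (\<Sum>x\<in>F. \<Sum>y\<in>F. c x * cnj (c y) * (f x * cnj (f y) * k x y))"
    by (simp add: mult_ac)
qed

lemma schur_factor_const: "r \<ge> 0 \<Longrightarrow> schur_factor Y (\<lambda>x y. of_real r)"
  by (rule schur_factor_cong[OF schur_factor_rank_one[of Y "\<lambda>_. of_real (sqrt r)"]])
    (simp flip: of_real_mult)

lemma schur_factor_scale:
  "r \<ge> 0 \<Longrightarrow> schur_factor Y s \<Longrightarrow> schur_factor Y (\<lambda>x y. of_real r * s x y)"
  by (rule schur_factor_mult[OF schur_factor_const])

lemma schur_factor_of_bool: "schur_factor Y (\<lambda>x y. of_bool (\<beta> x \<and> \<beta> y))"
  by (rule schur_factor_cong[OF schur_factor_rank_one[of Y "\<lambda>x. of_bool (\<beta> x)"]]) simp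

lemma schur_factor_prod:
  "(\<And>k. k \<in> A \<Longrightarrow> schur_factor Y (s k)) \<Longrightarrow> schur_factor Y (\<lambda>x y. \<Prod>k\<in>A. s k x y)"
proof (induction A rule: infinite_finite_induct)
  case (insert a A)
  then show ?case by (simp add: schur_factor_mult)
qed (use schur_factor_const[of 1 Y] in auto)

section \<open>The binomial series and its jets\<close>

text \<open>The Taylor coefficients of \<open>(1 - t) powr -s\<close>, which are positive for \<open>s > 0\<close>.\<close>

definition pow_coeff :: "real \<Rightarrow> nat \<Rightarrow> real" where
  "pow_coeff s m = pochhammer s m / fact m"

lemma pow_coeff_0 [simp]: "pow_coeff s 0 = 1"
  by (simp add: pow_coeff_def)

lemma pow_coeff_nonneg: "s > 0 \<Longrightarrow> pow_coeff s m \<ge> 0"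
  by (simp add: pow_coeff_def pochhammer_nonneg)

lemma pow_coeff_Suc: "real (Suc m) * pow_coeff s (Suc m) = (s + real m) * pow_coeff s m"
  by (simp add: pow_coeff_def pochhammer_Suc field_simps del: of_nat_Suc)

lemma pow_coeff_Suc': "real (Suc m) * pow_coeff s (Suc m) = s * pow_coeff (s + 1) m"
  by (simp add: pow_coeff_def pochhammer_rec field_simps del: of_nat_Suc)

text \<open>
  The weighted shift that multiplication by the variable induces on the space with kernel
  \<open>(1 - z cnj w) powr -s\<close> is bounded because of this comparison. The quotient \<open>(m + 1) / (s + m)\<close> of
  consecutive coefficients is at most \<open>max 1 (1 / s)\<close>; the sum of the two is easier to handle.
\<close>

lemma pow_coeff_le_Suc:
  assumes "s > 0" shows "pow_coeff s m \<le> (1 + 1 / s) * pow_coeff s (Suc m)"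
proof -
  have "real (Suc m) * pow_coeff s m \<le> ((1 + 1 / s) * (s + real m)) * pow_coeff s m"
    using assms by (intro mult_right_mono pow_coeff_nonneg) (auto simp: field_simps)
  also have "\<dots> = (1 + 1 / s) * ((s + real m) * pow_coeff s m)" by simp
  also have "\<dots> = (1 + 1 / s) * (real (Suc m) * pow_coeff s (Suc m))"
    by (simp only: pow_coeff_Suc)
  also have "\<dots> = real (Suc m) * ((1 + 1 / s) * pow_coeff s (Suc m))" by (simp only: mult_ac)
  finally show ?thesis by (simp del: of_nat_Suc)
qed

lemma pow_coeff_sums:
  assumes "norm (t :: complex) < 1"
  shows "(\<lambda>m. of_real (pow_coeff s m) * t ^ m) sums ((1 - t) powr of_real (- s))"
proof -
  have "(of_real (- s) gchoose m) * (- t) ^ m = of_real (pow_coeff s m) * t ^ m" for m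
  proof -
    have "(- 1) ^ m * (- t) ^ m = t ^ m" by (simp flip: power_mult_distrib)
    then show ?thesis
      by (simp add: gbinomial_pochhammer pow_coeff_def pochhammer_of_real divide_simps mult_ac)
  qed
  then show ?thesis using gen_binomial_complex[of "- t" "of_real (- s)"] assms by simp
qed

lemma norm_mult_cnj_less_1: "norm z < 1 \<Longrightarrow> norm w < 1 \<Longrightarrow> norm (z * cnj w) < 1"
  using mult_strict_mono'[of "norm z" 1 "norm w" 1] by (simp add: norm_mult)

lemma powr_neg_add_nat:
  assumes "x \<noteq> (0 :: complex)"
  shows "x powr of_real (- s - real n) = x powr of_real (- s) / x ^ n"
  using assms by (simp add: powr_diff powr_nat')

text \<open>
  With \<open>k = (1 - z cnj w) powr -s\<close>, the four values are \<open>k\<close>, \<open>\<partial>k / s\<close> for the derivative with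
  respect to \<open>z\<close> (flag \<open>b\<close>) or \<open>cnj w\<close> (flag \<open>c\<close>), and the mixed derivative divided by \<open>s\<^sup>2\<close>. In
  the same way \<open>jet_monom\<close> is \<open>z\<^sup>m\<close> or its derivative divided by \<open>s\<close>.
\<close>

definition jet_kernel :: "real \<Rightarrow> complex \<Rightarrow> complex \<Rightarrow> bool \<Rightarrow> bool \<Rightarrow> complex" where
  "jet_kernel s z w b c =
     (let A = 1 - z * cnj w in
      A powr of_real (- s) *
        ((if b then cnj w / A else 1) * (if c then z / A else 1)
         + of_bool (b \<and> c) / (of_real s * A\<^sup>2)))"

definition jet_monom :: "real \<Rightarrow> nat \<Rightarrow> complex \<Rightarrow> bool \<Rightarrow> complex" where
  "jet_monom s m z b = (if b then of_nat m * z ^ (m - 1) / of_real s else z ^ m)"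

lemma jet_monom_Suc:
  "jet_monom s (Suc m) z b =
    z * jet_monom s m z b + of_bool b / of_real s * jet_monom s m z False"
proof (cases m)
  case (Suc n)
  have "of_nat (Suc (Suc n)) * z ^ Suc n / of_real s
      = z * (of_nat (Suc n) * z ^ n / of_real s) + z ^ Suc n / of_real s"
    by (simp add: algebra_simps add_divide_distrib)
  then show ?thesis by (simp add: jet_monom_def Suc)
qed (simp add: jet_monom_def)

text \<open>
  Termwise differentiation of the binomial series, carried out on coefficients: differentiating
  the series with exponent \<open>-s\<close> gives \<open>s\<close> times the one with exponent \<open>-(s + 1)\<close>.
\<close>

lemma jet_kernel_sums:
  assumes s: "s > 0" and z: "norm z < 1" and w: "norm w < 1"
  shows "(\<lambda>m. of_real (pow_coeff s m) * (jet_monom s m z b * cnj (jet_monom s m w c)))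
    sums jet_kernel s z w b c"
proof -
  define t where "t = z * cnj w"
  have t: "norm t < 1" unfolding t_def by (rule norm_mult_cnj_less_1[OF z w])
  then have t1: "1 - t \<noteq> 0" by auto
  define p where "p = (1 - t) powr of_real (- s)"
  have p1: "(1 - t) powr of_real (- (s + 1)) = p / (1 - t)"
  proof -
    have "- (s + 1) = - s - real 1" by simp
    then show ?thesis using powr_neg_add_nat[OF t1, of s 1] by (simp only: p_def power_one_right)
  qed
  have p2: "(1 - t) powr of_real (- (s + 1 + 1)) = p / (1 - t)\<^sup>2"
  proof -
    have "- (s + 1 + 1) = - s - real 2" by simp
    then show ?thesis using powr_neg_add_nat[OF t1, of s 2] by (simp only: p_def)
  qed
  have c1: "of_nat (Suc m) * complex_of_real (pow_coeff s (Suc m)) =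
      of_real s * of_real (pow_coeff (s + 1) m)" for s m
    using arg_cong[OF pow_coeff_Suc'[of m s], of complex_of_real]
    by (simp only: of_real_mult of_real_of_nat_eq)
  have S0: "(\<lambda>m. of_real (pow_coeff s m) * t ^ m) sums p"
    unfolding p_def by (rule pow_coeff_sums[OF t])
  have S1: "(\<lambda>m. of_real (pow_coeff (s + 1) m) * t ^ m) sums (p / (1 - t))"
    using pow_coeff_sums[OF t, of "s + 1"] by (simp only: p1)
  have S2: "(\<lambda>m. of_nat m * of_real (pow_coeff (s + 1) m) * t ^ m) sums
      ((of_real s + 1) * t * (p / (1 - t)\<^sup>2))"
  proof -
    have "(\<lambda>m. (of_real s + 1) * t * (of_real (pow_coeff (s + 1 + 1) m) * t ^ m)) sums
        ((of_real s + 1) * t * (p / (1 - t)\<^sup>2))"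
      using sums_mult[OF pow_coeff_sums[OF t, of "s + 1 + 1"], of "(of_real s + 1) * t"]
      by (simp only: p2)
    moreover have "of_nat (Suc m) * of_real (pow_coeff (s + 1) (Suc m)) * t ^ Suc m =
        (of_real s + 1) * t * (of_real (pow_coeff (s + 1 + 1) m) * t ^ m)" for m
      by (simp only: c1 power_Suc of_real_add of_real_1 mult_ac)
    ultimately have "(\<lambda>m. of_nat (Suc m) * of_real (pow_coeff (s + 1) (Suc m)) * t ^ Suc m) sums
        ((of_real s + 1) * t * (p / (1 - t)\<^sup>2))" by presburger
    from sums_Suc[OF this] show ?thesis by simp
  qed
  let ?f = "\<lambda>m. of_real (pow_coeff s m) * (jet_monom s m z b * cnj (jet_monom s m w c))"
  have s0: "complex_of_real s \<noteq> 0" using s by simp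
  consider "\<not> b" "\<not> c" | "b" "\<not> c" | "\<not> b" "c" | "b" "c" by blast
  then show ?thesis
  proof cases
    case 1
    then show ?thesis using S0
      by (simp add: jet_kernel_def jet_monom_def p_def t_def power_mult_distrib)
  next
    case 2
    have "?f (Suc m) = of_real (pow_coeff (s + 1) m) * t ^ m * cnj w" for m
    proof -
      have "?f (Suc m) = (of_nat (Suc m) * of_real (pow_coeff s (Suc m))) / of_real s
          * (t ^ m * cnj w)"
        using 2 by (simp add: jet_monom_def t_def power_mult_distrib mult_ac)
      then show ?thesis using s0 by (simp add: c1 del: of_nat_Suc)
    qed
    then have "(\<lambda>m. ?f (Suc m)) sums (p / (1 - t) * cnj w)" using sums_mult2[OF S1] by simp
    from sums_Suc[OF this] show ?thesis using 2
      by (simp add: jet_kernel_def Let_def jet_monom_def p_def t_def)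
  next
    case 3
    have "?f (Suc m) = of_real (pow_coeff (s + 1) m) * t ^ m * z" for m
    proof -
      have "?f (Suc m) = (of_nat (Suc m) * of_real (pow_coeff s (Suc m))) / of_real s
          * (t ^ m * z)"
        using 3 by (simp add: jet_monom_def t_def power_mult_distrib mult_ac)
      then show ?thesis using s0 by (simp add: c1 del: of_nat_Suc)
    qed
    then have "(\<lambda>m. ?f (Suc m)) sums (p / (1 - t) * z)" using sums_mult2[OF S1] by simp
    from sums_Suc[OF this] show ?thesis using 3
      by (simp add: jet_kernel_def Let_def jet_monom_def p_def t_def)
  next
    case 4
    have "?f (Suc m) = (of_nat m * of_real (pow_coeff (s + 1) m) * t ^ m
        + of_real (pow_coeff (s + 1) m) * t ^ m) / of_real s" for m
    proof -
      have "?f (Suc m) = (of_nat (Suc m) * of_real (pow_coeff s (Suc m))) / of_real s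
          * (of_nat (Suc m) * t ^ m / of_real s)"
        using 4 by (simp add: jet_monom_def t_def power_mult_distrib mult_ac)
      also have "\<dots> = of_real (pow_coeff (s + 1) m) * (of_nat (Suc m) * t ^ m / of_real s)"
        using s0 by (simp add: c1 del: of_nat_Suc)
      finally show ?thesis by (simp add: algebra_simps add_divide_distrib)
    qed
    then have "(\<lambda>m. ?f (Suc m)) sums
        (((of_real s + 1) * t * (p / (1 - t)\<^sup>2) + p / (1 - t)) / of_real s)"
      using sums_divide[OF sums_add[OF S2 S1]] by simp
    from sums_Suc[OF this]
    have "?f sums (((of_real s + 1) * t * (p / (1 - t)\<^sup>2) + p / (1 - t)) / of_real s)"
      using 4 by (simp add: jet_monom_def)
    also have "((of_real s + 1) * t * (p / (1 - t)\<^sup>2) + p / (1 - t)) / of_real s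
        = p * (t / (1 - t)\<^sup>2 + 1 / (of_real s * (1 - t)\<^sup>2))"
      using t1 s0 by (simp add: divide_simps power2_eq_square) (simp add: algebra_simps)
    also have "\<dots> = jet_kernel s z w b c"
      using 4 by (simp add: jet_kernel_def Let_def p_def t_def power2_eq_square mult_ac)
    finally show ?thesis .
  qed
qed

text \<open>
  The sum of \<open>pow_coeff s m\<close> times the rank one kernel of the jet of the monomial of degree
  \<open>m + 1\<close>. The closed form results from expanding with \<open>jet_monom_Suc\<close>.
\<close>

definition jet_shift_kernel :: "real \<Rightarrow> complex \<Rightarrow> complex \<Rightarrow> bool \<Rightarrow> bool \<Rightarrow> complex" where
  "jet_shift_kernel s z w b c =
     z * cnj w * jet_kernel s z w b c
     + z * (of_bool c / of_real s) * jet_kernel s z w b False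
     + of_bool b / of_real s * cnj w * jet_kernel s z w False c
     + of_bool b / of_real s * (of_bool c / of_real s) * jet_kernel s z w False False"

lemma cnj_of_bool_divide: "cnj (of_bool b / of_real s) = of_bool b / of_real s"
  by simp

lemma jet_shift_kernel_sums:
  assumes s: "s > 0" and z: "norm z < 1" and w: "norm w < 1"
  shows "(\<lambda>m. of_real (pow_coeff s m) * (jet_monom s (Suc m) z b * cnj (jet_monom s (Suc m) w c)))
    sums jet_shift_kernel s z w b c"
proof -
  have expand: "a * ((z * X + B * Z) * (w' * X' + B' * Z')) =
      z * w' * (a * (X * X')) + z * B' * (a * (X * Z')) + B * w' * (a * (Z * X'))
      + B * B' * (a * (Z * Z'))" for a X B Z w' X' B' Z' :: complex
    by (simp add: algebra_simps)
  have "of_real (pow_coeff s m) * (jet_monom s (Suc m) z b * cnj (jet_monom s (Suc m) w c)) =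
      z * cnj w * (of_real (pow_coeff s m) * (jet_monom s m z b * cnj (jet_monom s m w c)))
     + z * (of_bool c / of_real s) *
        (of_real (pow_coeff s m) * (jet_monom s m z b * cnj (jet_monom s m w False)))
     + of_bool b / of_real s * cnj w *
        (of_real (pow_coeff s m) * (jet_monom s m z False * cnj (jet_monom s m w c)))
     + of_bool b / of_real s * (of_bool c / of_real s) *
        (of_real (pow_coeff s m) * (jet_monom s m z False * cnj (jet_monom s m w False)))" for m
    unfolding jet_monom_Suc complex_cnj_add complex_cnj_mult[of w] complex_cnj_mult[of "of_bool c / _"]
      cnj_of_bool_divide by (rule expand)
  note expanded = this
  show ?thesis
    unfolding jet_shift_kernel_def expanded
    by (intro sums_add sums_mult jet_kernel_sums[OF assms])
qed

section \<open>Multiplication by the variable on jets\<close>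

context
  fixes Y :: "'b set" and h :: "'b \<Rightarrow> complex"
  assumes h: "\<And>x. x \<in> Y \<Longrightarrow> norm (h x) < 1"
begin

lemma schur_factor_jet_kernel:
  assumes s: "s > 0"
  shows "schur_factor Y (\<lambda>x y. jet_kernel s (h x) (h y) (\<beta> x) (\<beta> y))"
proof (rule schur_factor_sums[where s = "\<lambda>m x y. of_real (pow_coeff s m) *
      (jet_monom s m (h x) (\<beta> x) * cnj (jet_monom s m (h y) (\<beta> y)))"])
  show "schur_factor Y (\<lambda>x y. of_real (pow_coeff s m) *
      (jet_monom s m (h x) (\<beta> x) * cnj (jet_monom s m (h y) (\<beta> y))))" for m
    by (intro schur_factor_scale schur_factor_rank_one pow_coeff_nonneg s)
qed (intro jet_kernel_sums s h)

lemma schur_factor_powr: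
  assumes "s > 0" shows "schur_factor Y (\<lambda>x y. (1 - h x * cnj (h y)) powr of_real (- s))"
  using schur_factor_jet_kernel[OF assms, of "\<lambda>_. False"] by (simp add: jet_kernel_def)

text \<open>
  Regrouped by powers, the difference is a series of rank one kernels whose coefficients are
  nonnegative by \<open>pow_coeff_le_Suc\<close>.
\<close>

lemma schur_factor_jet_backshift:
  assumes s: "s > 0"
  shows "schur_factor Y (\<lambda>x y. of_real (1 + 1 / s) * jet_kernel s (h x) (h y) (\<beta> x) (\<beta> y)
    - jet_shift_kernel s (h x) (h y) (\<beta> x) (\<beta> y))"
proof (rule schur_factor_sums)
  define d where "d m = (1 + 1 / s) * pow_coeff s m - (case m of 0 \<Rightarrow> 0 | Suc n \<Rightarrow> pow_coeff s n)" for m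
  have d: "d m \<ge> 0" for m
    using s pow_coeff_le_Suc[OF s] by (auto simp: d_def split: nat.split)
  show "schur_factor Y (\<lambda>x y. of_real (d m) *
      (jet_monom s m (h x) (\<beta> x) * cnj (jet_monom s m (h y) (\<beta> y))))" for m
    by (intro schur_factor_scale schur_factor_rank_one d)
  fix x y assume xy: "x \<in> Y" "y \<in> Y"
  let ?X = "\<lambda>m. jet_monom s m (h x) (\<beta> x) * cnj (jet_monom s m (h y) (\<beta> y))"
  define g where "g m = of_real (case m of 0 \<Rightarrow> 0 | Suc n \<Rightarrow> pow_coeff s n) * ?X m" for m
  have "g sums (jet_shift_kernel s (h x) (h y) (\<beta> x) (\<beta> y) + g 0)"
    by (rule sums_Suc) (simp add: g_def jet_shift_kernel_sums s h xy)
  moreover have "g 0 = 0" by (simp add: g_def)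
  ultimately have g: "g sums jet_shift_kernel s (h x) (h y) (\<beta> x) (\<beta> y)" by simp
  have S: "(\<lambda>m. of_real (1 + 1 / s) * (of_real (pow_coeff s m) * ?X m) - g m) sums
      (of_real (1 + 1 / s) * jet_kernel s (h x) (h y) (\<beta> x) (\<beta> y)
        - jet_shift_kernel s (h x) (h y) (\<beta> x) (\<beta> y))"
    by (intro sums_diff[OF _ g] sums_mult jet_kernel_sums s h xy)
  have eq: "of_real (1 + 1 / s) * (of_real (pow_coeff s m) * ?X m) - g m
      = of_real (d m) * ?X m" for m
    unfolding d_def g_def of_real_diff of_real_mult by (simp only: left_diff_distrib mult.assoc)
  show "(\<lambda>m. of_real (d m) * ?X m) sums
      (of_real (1 + 1 / s) * jet_kernel s (h x) (h y) (\<beta> x) (\<beta> y)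
        - jet_shift_kernel s (h x) (h y) (\<beta> x) (\<beta> y))"
    using S unfolding eq .
qed

text \<open>
  Let \<open>\<xi>\<close> be the jet of the monomial of degree \<open>m + 1\<close>, and \<open>\<eta>\<close> the error, so that \<open>z\<close> times
  the jet of the monomial of degree \<open>m\<close> is \<open>\<xi> - \<eta>\<close>. The parallelogram law
  \<open>2 \<xi> \<xi>\<^sup>* + 2 \<eta> \<eta>\<^sup>* - (\<xi> - \<eta>) (\<xi> - \<eta>)\<^sup>* = (\<xi> + \<eta>) (\<xi> + \<eta>)\<^sup>*\<close> summed over \<open>m\<close> bounds the kernel of the
  shifted jets by that of the jets of the shifted monomials and that of the errors.
\<close>

lemma schur_factor_jet_shift_defect:
  assumes s: "s > 0"
  shows "schur_factor Y (\<lambda>x y. 2 * jet_shift_kernel s (h x) (h y) (\<beta> x) (\<beta> y)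
     + 2 * (of_bool (\<beta> x) / of_real s * (of_bool (\<beta> y) / of_real s)
        * jet_kernel s (h x) (h y) False False)
     - h x * cnj (h y) * jet_kernel s (h x) (h y) (\<beta> x) (\<beta> y))"
proof (rule schur_factor_sums)
  have expand: "a * ((z * X + B * Z + B * Z) * (w' * X' + B' * Z' + B' * Z')) =
      2 * (a * ((z * X + B * Z) * (w' * X' + B' * Z'))) + 2 * (B * B' * (a * (Z * Z')))
      - z * w' * (a * (X * X'))" for a z X B Z w' X' B' Z' :: complex
    by (simp add: algebra_simps)
  define \<eta> where "\<eta> m x = of_bool (\<beta> x) / of_real s * jet_monom s m (h x) False" for m x
  show "schur_factor Y (\<lambda>x y. of_real (pow_coeff s m) *
      ((jet_monom s (Suc m) (h x) (\<beta> x) + \<eta> m x)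
        * cnj (jet_monom s (Suc m) (h y) (\<beta> y) + \<eta> m y)))" for m
    by (intro schur_factor_scale schur_factor_rank_one pow_coeff_nonneg s)
  fix x y assume xy: "x \<in> Y" "y \<in> Y"
  have "of_real (pow_coeff s m) * ((jet_monom s (Suc m) (h x) (\<beta> x) + \<eta> m x)
        * cnj (jet_monom s (Suc m) (h y) (\<beta> y) + \<eta> m y)) =
     2 * (of_real (pow_coeff s m) * (jet_monom s (Suc m) (h x) (\<beta> x)
        * cnj (jet_monom s (Suc m) (h y) (\<beta> y))))
     + 2 * (of_bool (\<beta> x) / of_real s * (of_bool (\<beta> y) / of_real s)
        * (of_real (pow_coeff s m) * (jet_monom s m (h x) False * cnj (jet_monom s m (h y) False))))
     - h x * cnj (h y) * (of_real (pow_coeff s m) *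
        (jet_monom s m (h x) (\<beta> x) * cnj (jet_monom s m (h y) (\<beta> y))))" for m
    unfolding jet_monom_Suc complex_cnj_add complex_cnj_mult[of "h y"]
      complex_cnj_mult[of "of_bool (\<beta> y) / _"] cnj_of_bool_divide \<eta>_def by (rule expand)
  note expanded = this
  show "(\<lambda>m. of_real (pow_coeff s m) * ((jet_monom s (Suc m) (h x) (\<beta> x) + \<eta> m x)
        * cnj (jet_monom s (Suc m) (h y) (\<beta> y) + \<eta> m y))) sums
     (2 * jet_shift_kernel s (h x) (h y) (\<beta> x) (\<beta> y)
     + 2 * (of_bool (\<beta> x) / of_real s * (of_bool (\<beta> y) / of_real s)
        * jet_kernel s (h x) (h y) False False)
     - h x * cnj (h y) * jet_kernel s (h x) (h y) (\<beta> x) (\<beta> y))"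
    unfolding expanded
    by (intro sums_add sums_diff sums_mult jet_kernel_sums jet_shift_kernel_sums s h xy)
qed

text \<open>This is the case of \<open>schur_factor_jet_backshift\<close> in which no point carries a derivative.\<close>

lemma schur_factor_shift_powr:
  assumes s: "s > 0" and C: "C \<ge> 1 + 1 / s"
  shows "schur_factor Y (\<lambda>x y. (of_real C - h x * cnj (h y)) *
    (1 - h x * cnj (h y)) powr of_real (- s))"
proof -
  have "schur_factor Y (\<lambda>x y. of_real (C - (1 + 1 / s)) * jet_kernel s (h x) (h y) False False
      + (of_real (1 + 1 / s) * jet_kernel s (h x) (h y) False False
          - jet_shift_kernel s (h x) (h y) False False))"
    using C schur_factor_jet_kernel[OF s, of "\<lambda>_. False"]
      schur_factor_jet_backshift[OF s, of "\<lambda>_. False"]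
    by (intro schur_factor_add schur_factor_scale) auto
  then show ?thesis
    by (rule schur_factor_cong)
      (simp add: jet_shift_kernel_def jet_kernel_def Let_def algebra_simps)
qed

text \<open>
  Two copies of the back shift and the defect leave an error \<open>-\<kappa> (1 - t) powr -s\<close> between the points
  carrying a derivative, with \<open>t = h x cnj (h y)\<close> and \<open>\<kappa> = 2 / s\<^sup>2\<close>. The added summand of weight
  \<open>e\<close> compensates for it, as \<open>(1 - t) powr -s\<close> equals
  \<open>(1 - t) powr (-s - 2) - t ((1 - t) powr (-s - 2) + (1 - t) powr (-s - 1))\<close>.
\<close>

lemma schur_factor_shift_jet:
  assumes s: "s > 0" and e: "e > 0"
    and C: "C \<ge> 2 * (1 + 1 / s)" "C \<ge> 1 + 2 / (e * s\<^sup>2)"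
  shows "schur_factor Y (\<lambda>x y. (of_real C - h x * cnj (h y)) *
    (jet_kernel s (h x) (h y) (\<beta> x) (\<beta> y)
      + of_real e * (of_bool (\<beta> x \<and> \<beta> y) * (1 - h x * cnj (h y)) powr of_real (- s - 2))))"
proof -
  define \<kappa> where "\<kappa> = 2 / s\<^sup>2"
  define jk where "jk x y = jet_kernel s (h x) (h y) (\<beta> x) (\<beta> y)" for x y
  define L where "L x y = jet_shift_kernel s (h x) (h y) (\<beta> x) (\<beta> y)" for x y
  define D where "D x y = 2 * L x y
     + 2 * (of_bool (\<beta> x) / of_real s * (of_bool (\<beta> y) / of_real s)
        * jet_kernel s (h x) (h y) False False) - h x * cnj (h y) * jk x y" for x y
  have "e * (C - 1) \<ge> e * (2 / (e * s\<^sup>2))" using C(2) e by (intro mult_left_mono) auto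
  then have \<kappa>: "\<kappa> \<ge> 0" "e * (C - 1) - \<kappa> \<ge> 0" using e by (auto simp: \<kappa>_def)
  have "schur_factor Y (\<lambda>x y. of_real (C - 2 * (1 + 1 / s)) * jk x y
      + (of_real 2 * (of_real (1 + 1 / s) * jk x y - L x y) + D x y)
      + of_bool (\<beta> x \<and> \<beta> y) *
        (of_real (e * (C - 1) - \<kappa>) * (1 - h x * cnj (h y)) powr of_real (- (s + 2))
         + (of_real e * (1 - h x * cnj (h y)) powr of_real (- (s + 1))
         + of_real \<kappa> * (h x * cnj (h y) * ((1 - h x * cnj (h y)) powr of_real (- (s + 2))
            + (1 - h x * cnj (h y)) powr of_real (- (s + 1)))))))"
    unfolding jk_def L_def D_def using \<kappa> C e s
    by (intro schur_factor_add schur_factor_mult[OF schur_factor_of_bool] schur_factor_scale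
      schur_factor_powr schur_factor_jet_kernel schur_factor_jet_backshift
      schur_factor_jet_shift_defect schur_factor_mult[OF schur_factor_rank_one]) auto
  then show ?thesis
  proof (rule schur_factor_cong)
    fix x y assume "x \<in> Y" "y \<in> Y"
    define t p where "t = h x * cnj (h y)" and "p = (1 - t) powr of_real (- s - 2)"
    have t1: "1 - t \<noteq> 0" using norm_mult_cnj_less_1[OF h[OF \<open>x \<in> Y\<close>] h[OF \<open>y \<in> Y\<close>]]
      by (auto simp: t_def)
    have p2: "(1 - t) powr of_real (- (s + 2)) = p" by (simp add: p_def algebra_simps)
    have q: "(1 - t) powr of_real (- s) = p * (1 - t)\<^sup>2"
      using powr_neg_add_nat[OF t1, of s 2] t1 by (simp add: p_def)
    have "- (s + 1) = - s - real 1" by simp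
    then have p1: "(1 - t) powr of_real (- (s + 1)) = p * (1 - t)"
      using powr_neg_add_nat[OF t1, of s 1] t1 q by (simp only: power2_eq_square) simp
    have k: "complex_of_real \<kappa> * of_bool (\<beta> x \<and> \<beta> y) =
        2 * (of_bool (\<beta> x) / of_real s * (of_bool (\<beta> y) / of_real s))"
      by (simp add: \<kappa>_def power2_eq_square)
    have "2 * (of_bool (\<beta> x) / of_real s * (of_bool (\<beta> y) / of_real s)
        * jet_kernel s (h x) (h y) False False)
        = complex_of_real \<kappa> * of_bool (\<beta> x \<and> \<beta> y) * (p * (1 - t)\<^sup>2)"
      unfolding k using q by (simp add: jet_kernel_def t_def)
    then have D: "D x y = 2 * L x y + of_real \<kappa> * of_bool (\<beta> x \<and> \<beta> y) * (p * (1 - t)\<^sup>2) - t * jk x y"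
      by (simp add: D_def t_def)
    show "(of_real C - h x * cnj (h y)) * (jet_kernel s (h x) (h y) (\<beta> x) (\<beta> y)
        + of_real e * (of_bool (\<beta> x \<and> \<beta> y) * (1 - h x * cnj (h y)) powr of_real (- s - 2))) =
      of_real (C - 2 * (1 + 1 / s)) * jk x y
      + (of_real 2 * (of_real (1 + 1 / s) * jk x y - L x y) + D x y)
      + of_bool (\<beta> x \<and> \<beta> y) *
        (of_real (e * (C - 1) - \<kappa>) * (1 - h x * cnj (h y)) powr of_real (- (s + 2))
         + (of_real e * (1 - h x * cnj (h y)) powr of_real (- (s + 1))
         + of_real \<kappa> * (h x * cnj (h y) * ((1 - h x * cnj (h y)) powr of_real (- (s + 2))
            + (1 - h x * cnj (h y)) powr of_real (- (s + 1))))))"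
      unfolding t_def[symmetric] p2 p1 p_def[symmetric] jk_def[symmetric] D
      unfolding of_real_diff of_real_mult
      by (simp add: algebra_simps power2_eq_square)
  qed
qed

end

section \<open>Operators on reproducing kernel Hilbert spaces\<close>

definition adj_mat :: "complex^'n^'m \<Rightarrow> complex^'m^'n" where
  "adj_mat A = (\<chi> r q. cnj (A $ q $ r))"

lemma adj_mat_mult: "adj_mat (A ** B) = adj_mat B ** adj_mat A"
  by (simp add: adj_mat_def matrix_matrix_mult_def vec_eq_iff mult.commute)

lemma adj_mat_1 [simp]: "adj_mat (mat 1) = mat 1"
  by (auto simp: adj_mat_def mat_def vec_eq_iff)

lemma mult_axis_nth: "(A *v axis q 1) $ p = A $ p $ (q :: 'm::finite)"
  for A :: "complex^'m^'n"
  by (simp add: matrix_vector_mult_def axis_def if_distrib cong: if_cong)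

lemma cvec_ip_axis: "cvec_ip v (axis q 1) = v $ (q :: 'm::finite)"
  by (simp add: cvec_ip_def axis_def if_distrib cong: if_cong)

locale rkhs =
  fixes \<Omega> :: "'a set" and K :: "'a \<Rightarrow> 'a \<Rightarrow> complex^'m^'m" and H :: "('a \<Rightarrow> complex^'m) hilbert"
  assumes rkhs: "is_rkhs \<Omega> K H"

sublocale rkhs \<subseteq> chilbert_space H
  using rkhs by (simp add: is_rkhs_def)

context rkhs
begin

lemma scl_eq: "scl H c f z = c *s f z"
  using rkhs by (simp add: is_rkhs_def)

lemma vanish: "f \<in> vecs H \<Longrightarrow> z \<notin> \<Omega> \<Longrightarrow> f z = 0"
  using rkhs by (simp add: is_rkhs_def)

lemma section_mem: "w \<in> \<Omega> \<Longrightarrow> kernel_section \<Omega> K w \<zeta> \<in> vecs H"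
  using rkhs by (simp add: is_rkhs_def)

lemma reproducing:
  "w \<in> \<Omega> \<Longrightarrow> f \<in> vecs H \<Longrightarrow> ip H f (kernel_section \<Omega> K w \<zeta>) = cvec_ip (f w) \<zeta>"
  using rkhs by (simp add: is_rkhs_def)

definition ev :: "'a \<times> 'm \<Rightarrow> 'a \<Rightarrow> complex^'m" where
  "ev x = kernel_section \<Omega> K (fst x) (axis (snd x) 1)"

definition kfun :: "'a \<times> 'm \<Rightarrow> 'a \<times> 'm \<Rightarrow> complex" where
  "kfun x y = K (fst x) (fst y) $ snd x $ snd y"

lemma ev_mem: "x \<in> \<Omega> \<times> UNIV \<Longrightarrow> ev x \<in> vecs H"
  by (auto simp: ev_def section_mem)

lemma ip_ev: "x \<in> \<Omega> \<times> UNIV \<Longrightarrow> f \<in> vecs H \<Longrightarrow> ip H f (ev x) = f (fst x) $ snd x"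
  by (auto simp: ev_def reproducing cvec_ip_axis)

lemma ip_ev_ev: "x \<in> \<Omega> \<times> UNIV \<Longrightarrow> y \<in> \<Omega> \<times> UNIV \<Longrightarrow> ip H (ev y) (ev x) = kfun x y"
  by (auto simp: ip_ev ev_mem) (auto simp: ev_def kernel_section_def kfun_def mult_axis_nth)

lemma hnorm_sum_sq:
  assumes "F \<subseteq> Y" "e \<in> Y \<rightarrow> vecs H"
  shows "(hnorm H (\<Sum>x\<in>F. scl H (c x) (e x)))\<^sup>2 =
    Re (\<Sum>x\<in>F. \<Sum>y\<in>F. cnj (c x) * cnj (cnj (c y)) * ip H (e y) (e x))"
proof -
  have m: "scl H (c x) (e x) \<in> vecs H" "e x \<in> vecs H" if "x \<in> F" for x
    using that assms by (auto intro: scl_mem)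
  have "ip H (\<Sum>x\<in>F. scl H (c x) (e x)) (\<Sum>x\<in>F. scl H (c x) (e x)) =
      (\<Sum>x\<in>F. \<Sum>y\<in>F. cnj (c x) * (c y * ip H (e y) (e x)))"
    by (simp add: m ip_sum_left ip_sum_right sum_mem ip_scl_left ip_scl_right sum_distrib_left)
  also have "\<dots> = (\<Sum>x\<in>F. \<Sum>y\<in>F. cnj (c x) * cnj (cnj (c y)) * ip H (e y) (e x))"
    by (simp add: mult_ac)
  finally show ?thesis using m by (simp add: hnorm_sq sum_mem)
qed

text \<open>
  The Aronszajn criterion: if \<open>E\<close> is dominated by \<open>C\<close> times the evaluation vectors in the sense of
  kernels, then \<open>ev x \<mapsto> E x\<close> extends to a bounded operator, and \<open>g\<close> is its adjoint applied to
  \<open>f\<close>. A relation on linear combinations is used because the evaluation vectors may be linearly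
  dependent.
\<close>

lemma image_of_sections:
  assumes E: "\<And>x. x \<in> \<Omega> \<times> UNIV \<Longrightarrow> E x \<in> vecs H"
    and C: "C \<ge> 0"
    and pos: "pos_kernel (\<Omega> \<times> UNIV) (\<lambda>x y. of_real (C\<^sup>2) * kfun x y - ip H (E y) (E x))"
    and f: "f \<in> vecs H"
  shows "\<exists>g\<in>vecs H. (\<forall>x\<in>\<Omega> \<times> UNIV. g (fst x) $ snd x = ip H f (E x)) \<and> hnorm H g \<le> C * hnorm H f"
proof -
  let ?Y = "\<Omega> \<times> (UNIV :: 'm set)"
  define lin where "lin F c e = (\<Sum>x\<in>F. scl H (c x) (e x :: 'a \<Rightarrow> complex^'m))"
    for F :: "('a \<times> 'm) set" and c e
  define P where "P = {(u, v). \<exists>F c. finite F \<and> F \<subseteq> ?Y \<and> u = lin F c ev \<and> v = lin F c E}"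
  have P_iff: "(u, v) \<in> P \<longleftrightarrow> (\<exists>F c. finite F \<and> F \<subseteq> ?Y \<and> u = lin F c ev \<and> v = lin F c E)" for u v
    by (simp add: P_def)
  have P_I: "(lin F c ev, lin F c E) \<in> P" if "finite F" "F \<subseteq> ?Y" for F c
    unfolding P_iff by (rule exI[of _ F], rule exI[of _ c]) (simp add: that)
  have evY: "ev \<in> ?Y \<rightarrow> vecs H" and EY: "E \<in> ?Y \<rightarrow> vecs H"
    using ev_mem E by auto
  have lin_mem: "lin F c e \<in> vecs H" if "F \<subseteq> ?Y" "e \<in> ?Y \<rightarrow> vecs H" for F c e
    using that by (auto simp: lin_def intro!: sum_mem scl_mem)
  have lin_mono: "lin F c e = lin G (\<lambda>x. if x \<in> F then c x else 0) e"
    if "finite G" "G \<subseteq> ?Y" "F \<subseteq> G" "e \<in> ?Y \<rightarrow> vecs H" for F G c e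
    unfolding lin_def using that by (intro sum.mono_neutral_cong_left) (auto intro!: scl_zero simp: Pi_iff subset_iff)
  have lin_add: "lin G (\<lambda>x. c x + d x) e = lin G c e + lin G d e"
    if "G \<subseteq> ?Y" "e \<in> ?Y \<rightarrow> vecs H" for G c d e
  proof -
    have "lin G (\<lambda>x. c x + d x) e = (\<Sum>x\<in>G. scl H (c x) (e x) + scl H (d x) (e x))"
      unfolding lin_def using that by (intro sum.cong refl scl_add_left) blast
    then show ?thesis by (simp add: lin_def sum.distrib)
  qed
  have lin_scl: "scl H a (lin G c e) = lin G (\<lambda>x. a * c x) e"
    if "G \<subseteq> ?Y" "e \<in> ?Y \<rightarrow> vecs H" for G a c e
  proof -
    have "scl H a (lin G c e) = (\<Sum>x\<in>G. scl H a (scl H (c x) (e x)))"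
      unfolding lin_def using that by (intro scl_sum scl_mem) blast
    also have "\<dots> = lin G (\<lambda>x. a * c x) e"
      unfolding lin_def using that by (intro sum.cong refl scl_scl) blast
    finally show ?thesis .
  qed
  have "\<exists>g\<in>vecs H. (\<forall>(u, v)\<in>P. ip H g u = ip H f v) \<and> hnorm H g \<le> C * hnorm H f"
  proof (rule adjoint_of_bounded_relation[OF _ _ _ _ _ C f])
    show "P \<subseteq> vecs H \<times> vecs H" by (auto simp: P_def intro!: lin_mem evY EY)
    have "(lin {} (\<lambda>_. 0) ev, lin {} (\<lambda>_. 0) E) \<in> P" by (intro P_I) auto
    then show "(0, 0) \<in> P" by (simp add: lin_def)
    show "(scl H a u, scl H a v) \<in> P" if inP: "(u, v) \<in> P" for a u v
    proof -
      obtain F c where F: "finite F" "F \<subseteq> ?Y" and uv: "u = lin F c ev" "v = lin F c E"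
        using inP unfolding P_iff by blast
      show ?thesis
        unfolding uv lin_scl[OF F(2) evY] lin_scl[OF F(2) EY] by (rule P_I[OF F])
    qed
    show "(u + u', v + v') \<in> P" if inP: "(u, v) \<in> P" "(u', v') \<in> P" for u v u' v'
    proof -
      obtain F c where F: "finite F" "F \<subseteq> ?Y" and uv: "u = lin F c ev" "v = lin F c E"
        using inP unfolding P_iff by blast
      obtain F' c' where F': "finite F'" "F' \<subseteq> ?Y" and uv': "u' = lin F' c' ev" "v' = lin F' c' E"
        using inP unfolding P_iff by blast
      let ?d = "\<lambda>x. (if x \<in> F then c x else 0) + (if x \<in> F' then c' x else 0)"
      have G: "finite (F \<union> F')" "F \<union> F' \<subseteq> ?Y" using F F' by auto
      have *: "lin F c e + lin F' c' e = lin (F \<union> F') ?d e"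
        if e: "e \<in> ?Y \<rightarrow> vecs H" for e
        unfolding lin_add[OF G(2) e] lin_mono[OF G Un_upper1 e, of c]
          lin_mono[OF G Un_upper2 e, of c'] ..
      show ?thesis
        unfolding uv uv' *[OF evY] *[OF EY] by (rule P_I[OF G])
    qed
    show "hnorm H v \<le> C * hnorm H u" if inP: "(u, v) \<in> P" for u v
    proof -
      obtain F c where F: "finite F" "F \<subseteq> ?Y" and uv: "u = lin F c ev" "v = lin F c E"
        using inP unfolding P_iff by blast
      have Re_lin: "Re (of_real r * a - b) = r * Re a - Re b" for r a b by simp
      have u: "u \<in> vecs H" unfolding uv by (rule lin_mem[OF F(2) evY])
      have "0 \<le> Re (\<Sum>x\<in>F. \<Sum>y\<in>F. cnj (c x) * cnj (cnj (c y)) *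
          (of_real (C\<^sup>2) * kfun x y - ip H (E y) (E x)))"
        using pos[unfolded pos_kernel_def, rule_format, OF F, of "\<lambda>x. cnj (c x)"] .
      also have "(\<Sum>x\<in>F. \<Sum>y\<in>F. cnj (c x) * cnj (cnj (c y)) *
          (of_real (C\<^sup>2) * kfun x y - ip H (E y) (E x))) =
          of_real (C\<^sup>2) * (\<Sum>x\<in>F. \<Sum>y\<in>F. cnj (c x) * cnj (cnj (c y)) * ip H (ev y) (ev x))
          - (\<Sum>x\<in>F. \<Sum>y\<in>F. cnj (c x) * cnj (cnj (c y)) * ip H (E y) (E x))"
      proof -
        have "ip H (ev y) (ev x) = kfun x y" if "x \<in> F" "y \<in> F" for x y
          using that F by (intro ip_ev_ev) auto
        then have "(\<Sum>x\<in>F. \<Sum>y\<in>F. cnj (c x) * cnj (cnj (c y)) * ip H (ev y) (ev x)) =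
            (\<Sum>x\<in>F. \<Sum>y\<in>F. cnj (c x) * cnj (cnj (c y)) * kfun x y)"
          by (intro sum.cong refl) simp
        then show ?thesis
          by (simp only: right_diff_distrib sum_subtractf sum_distrib_left mult_ac)
      qed
      also have "Re \<dots> = C\<^sup>2 * (hnorm H u)\<^sup>2 - (hnorm H v)\<^sup>2"
        unfolding uv lin_def hnorm_sum_sq[OF F(2) evY, where c = c] hnorm_sum_sq[OF F(2) EY, where c = c]
        by (rule Re_lin)
      finally have "(hnorm H v)\<^sup>2 \<le> (C * hnorm H u)\<^sup>2" by (simp add: power_mult_distrib)
      then show ?thesis by (rule power2_le_imp_le) (simp add: C hnorm_ge_0[OF u])
    qed
  qed
  then obtain g where g: "g \<in> vecs H" "\<And>u v. (u, v) \<in> P \<Longrightarrow> ip H g u = ip H f v"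
      "hnorm H g \<le> C * hnorm H f" by blast
  have "g (fst x) $ snd x = ip H f (E x)" if x: "x \<in> ?Y" for x
  proof -
    have "(lin {x} (\<lambda>_. 1) ev, lin {x} (\<lambda>_. 1) E) \<in> P" using x by (intro P_I) auto
    then have "(ev x, E x) \<in> P" using x by (simp add: lin_def scl_one ev_mem E)
    from g(2)[OF this] show ?thesis using ip_ev[OF x g(1)] by simp
  qed
  with g(1,3) show ?thesis by blast
qed

lemma bounded_operator_from_sections:
  fixes T :: "('a \<Rightarrow> complex^'m) \<Rightarrow> 'a \<Rightarrow> complex^'m"
  assumes E: "\<And>x. x \<in> \<Omega> \<times> UNIV \<Longrightarrow> E x \<in> vecs H"
    and C: "C \<ge> 0"
    and pos: "pos_kernel (\<Omega> \<times> UNIV) (\<lambda>x y. of_real (C\<^sup>2) * kfun x y - ip H (E y) (E x))"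
    and T: "\<And>f z p. f \<in> vecs H \<Longrightarrow> z \<in> \<Omega> \<Longrightarrow> T f z $ p = ip H f (E (z, p))"
    and T0: "\<And>f z. f \<in> vecs H \<Longrightarrow> z \<notin> \<Omega> \<Longrightarrow> T f z = 0"
  shows "linear_operator H T" "\<And>f. f \<in> vecs H \<Longrightarrow> hnorm H (T f) \<le> C * hnorm H f"
proof -
  have *: "T f \<in> vecs H \<and> hnorm H (T f) \<le> C * hnorm H f" if f: "f \<in> vecs H" for f
  proof -
    obtain g where g: "g \<in> vecs H" "\<forall>x\<in>\<Omega> \<times> UNIV. g (fst x) $ snd x = ip H f (E x)"
      "hnorm H g \<le> C * hnorm H f"
      using image_of_sections[OF E C pos f] by blast
    have "T f z = g z" for z
    proof (cases "z \<in> \<Omega>")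
      case True
      then show ?thesis using g(2) T[OF f True] by (auto simp: vec_eq_iff)
    qed (simp add: T0[OF f] vanish[OF g(1)])
    then have "T f = g" by blast
    with g show ?thesis by simp
  qed
  then show "hnorm H (T f) \<le> C * hnorm H f" if "f \<in> vecs H" for f using that by blast
  have "T (f + g) z = T f z + T g z" if "f \<in> vecs H" "g \<in> vecs H" for f g z
    using that T0 by (cases "z \<in> \<Omega>") (auto simp: vec_eq_iff T add_mem ip_add_left E)
  moreover have "T (scl H a f) z = a *s T f z" if "f \<in> vecs H" for f a z
    using that T0 by (cases "z \<in> \<Omega>") (auto simp: vec_eq_iff T scl_mem ip_scl_left E)
  ultimately show "linear_operator H T"
    using * by (auto simp: linear_operator_def fun_eq_iff scl_eq)
qed

text \<open>
  The adjoint of a multiplication operator has the evaluation vectors as eigenvectors, with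
  eigenvalues \<open>cnj (h z)\<close>.
\<close>

lemma bounded_operator_mult:
  assumes C: "C \<ge> 0"
    and pos: "pos_kernel (\<Omega> \<times> UNIV) (\<lambda>x y. (of_real (C\<^sup>2) - h (fst x) * cnj (h (fst y))) * kfun x y)"
  shows "bounded_operator H (\<lambda>f z. h z *s f z)"
proof -
  let ?E = "\<lambda>x. scl H (cnj (h (fst x))) (ev x)"
  have E: "?E x \<in> vecs H" if "x \<in> \<Omega> \<times> UNIV" for x
    using that by (intro scl_mem ev_mem)
  have "pos_kernel (\<Omega> \<times> UNIV) (\<lambda>x y. of_real (C\<^sup>2) * kfun x y - ip H (?E y) (?E x))"
    by (rule pos_kernel_cong[OF pos])
      (simp add: ip_scl_left ip_scl_right scl_mem ev_mem ip_ev_ev algebra_simps)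
  note * = bounded_operator_from_sections[OF E C this, of "\<lambda>f z. h z *s f z"]
  show ?thesis unfolding bounded_operator_def
    using * by (auto simp: ip_scl_right ev_mem ip_ev vanish)
qed

definition weighted_comp :: "('a \<Rightarrow> complex^'m^'m) \<Rightarrow> ('a \<Rightarrow> 'a) \<Rightarrow> ('a \<Rightarrow> complex^'m) \<Rightarrow> 'a \<Rightarrow> complex^'m"
  where "weighted_comp J \<psi> f z = (if z \<in> \<Omega> then J z *v f (\<psi> z) else 0)"

text \<open>
  The vectors \<open>E x\<close> representing \<open>f \<mapsto> weighted_comp J \<psi> f\<close> have, by the transformation rule, the
  same Gram matrix as the evaluation vectors.
\<close>

lemma weighted_comp_contraction:
  assumes \<psi>: "\<And>z. z \<in> \<Omega> \<Longrightarrow> \<psi> z \<in> \<Omega>"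
    and K: "\<And>z w. z \<in> \<Omega> \<Longrightarrow> w \<in> \<Omega> \<Longrightarrow> K z w = J z ** K (\<psi> z) (\<psi> w) ** adj_mat (J w)"
  shows "linear_operator H (weighted_comp J \<psi>)"
    "\<And>f. f \<in> vecs H \<Longrightarrow> hnorm H (weighted_comp J \<psi> f) \<le> hnorm H f"
proof -
  let ?E = "\<lambda>x. kernel_section \<Omega> K (\<psi> (fst x)) (\<chi> r. cnj (J (fst x) $ snd x $ r))"
  have E: "?E x \<in> vecs H" if "x \<in> \<Omega> \<times> UNIV" for x
    using that \<psi> by (auto intro: section_mem)
  have ipE: "ip H f (?E (z, p)) = (J z *v f (\<psi> z)) $ p" if "f \<in> vecs H" "z \<in> \<Omega>" for f z p
    using that \<psi> by (simp add: reproducing cvec_ip_def matrix_vector_mult_def mult.commute)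
  have "ip H (?E y) (?E x) = kfun x y" if "x \<in> \<Omega> \<times> UNIV" "y \<in> \<Omega> \<times> UNIV" for x y
  proof -
    obtain z p w q where xy: "x = (z, p)" "y = (w, q)" by fastforce
    have zw: "z \<in> \<Omega>" "w \<in> \<Omega>" using that xy by auto
    let ?v = "\<chi> r. cnj (J w $ q $ r)"
    have v: "?v = adj_mat (J w) *v axis q 1"
      by (simp add: vec_eq_iff mult_axis_nth) (simp add: adj_mat_def)
    have "ip H (?E y) (?E x) = (J z *v (?E y) (\<psi> z)) $ p"
      using ipE[OF E[OF that(2)] zw(1), of p] xy by simp
    also have "\<dots> = (J z *v (K (\<psi> z) (\<psi> w) *v ?v)) $ p"
      using \<psi>[OF zw(1)] by (simp add: kernel_section_def xy)
    also have "\<dots> = K z w $ p $ q"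
      unfolding v K[OF zw] by (simp add: matrix_vector_mul_assoc mult_axis_nth matrix_mul_assoc)
    finally show ?thesis by (simp add: kfun_def xy)
  qed
  note ipEE = this
  have zero: "pos_kernel (\<Omega> \<times> UNIV) (\<lambda>(x :: 'a \<times> 'm) y. 0)"
    using schur_factor_imp_pos_kernel[OF schur_factor_const[of 0]] by simp
  have "pos_kernel (\<Omega> \<times> UNIV) (\<lambda>x y. of_real (1\<^sup>2) * kfun x y - ip H (?E y) (?E x))"
    by (rule pos_kernel_cong[OF zero]) (simp only: ipEE, simp)
  note * = bounded_operator_from_sections[OF E zero_le_one this, of "weighted_comp J \<psi>"]
  show "linear_operator H (weighted_comp J \<psi>)"
    by (rule *(1)) (use ipE in \<open>auto simp: weighted_comp_def\<close>)
  have "hnorm H (weighted_comp J \<psi> f) \<le> 1 * hnorm H f" if "f \<in> vecs H" for f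
    by (rule *(2)[OF _ _ _ that]) (use ipE in \<open>auto simp: weighted_comp_def\<close>)
  then show "hnorm H (weighted_comp J \<psi> f) \<le> hnorm H f" if "f \<in> vecs H" for f using that by simp
qed

text \<open>
  The inverse transformation satisfies a rule of the same form, so both operators are contractions
  and, being inverse to each other, isometries.
\<close>

lemma weighted_comp_unitary:
  assumes \<psi>: "\<And>z. z \<in> \<Omega> \<Longrightarrow> \<psi> z \<in> \<Omega>" and \<phi>: "\<And>z. z \<in> \<Omega> \<Longrightarrow> \<phi> z \<in> \<Omega>"
    and inv: "\<And>z. z \<in> \<Omega> \<Longrightarrow> \<psi> (\<phi> z) = z" "\<And>z. z \<in> \<Omega> \<Longrightarrow> \<phi> (\<psi> z) = z"
    and J: "\<And>z. z \<in> \<Omega> \<Longrightarrow> J' z ** J (\<phi> z) = mat 1"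
    and K: "\<And>z w. z \<in> \<Omega> \<Longrightarrow> w \<in> \<Omega> \<Longrightarrow> K z w = J z ** K (\<psi> z) (\<psi> w) ** adj_mat (J w)"
  shows "unitary_operator H (weighted_comp J \<psi>)"
    "unitary_operator H (weighted_comp J' \<phi>)"
    "\<And>f. f \<in> vecs H \<Longrightarrow> weighted_comp J \<psi> (weighted_comp J' \<phi> f) = f"
    "\<And>f. f \<in> vecs H \<Longrightarrow> weighted_comp J' \<phi> (weighted_comp J \<psi> f) = f"
proof -
  let ?U = "weighted_comp J \<psi>" and ?V = "weighted_comp J' \<phi>"
  have K': "K z w = J' z ** K (\<phi> z) (\<phi> w) ** adj_mat (J' w)" if "z \<in> \<Omega>" "w \<in> \<Omega>" for z w
  proof -
    have "J' z ** K (\<phi> z) (\<phi> w) ** adj_mat (J' w) =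
        (J' z ** J (\<phi> z)) ** K z w ** adj_mat (J' w ** J (\<phi> w))"
      using K[of "\<phi> z" "\<phi> w"] that by (simp add: \<phi> inv matrix_mul_assoc adj_mat_mult)
    then show ?thesis by (simp add: J that)
  qed
  have U: "linear_operator H ?U" "\<And>f. f \<in> vecs H \<Longrightarrow> hnorm H (?U f) \<le> hnorm H f"
    by (rule weighted_comp_contraction; (rule \<psi> K | assumption)+)+
  have V: "linear_operator H ?V" "\<And>f. f \<in> vecs H \<Longrightarrow> hnorm H (?V f) \<le> hnorm H f"
    by (rule weighted_comp_contraction; (rule \<phi> K' | assumption)+)+
  have J2: "J z ** J' (\<psi> z) = mat 1" if "z \<in> \<Omega>" for z
    using J[OF \<psi>[OF that]] that by (simp add: inv matrix_left_right_inverse)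
  show UV: "?U (?V f) = f" if "f \<in> vecs H" for f
    using that by (auto simp: weighted_comp_def fun_eq_iff \<psi> inv matrix_vector_mul_assoc J2 vanish)
  show VU: "?V (?U f) = f" if "f \<in> vecs H" for f
    using that by (auto simp: weighted_comp_def fun_eq_iff \<phi> inv matrix_vector_mul_assoc J vanish)
  have memU: "?U f \<in> vecs H" and memV: "?V f \<in> vecs H" if "f \<in> vecs H" for f
    using U(1) V(1) that by (auto simp: linear_operator_def)
  have nU: "hnorm H (?U f) = hnorm H f" if "f \<in> vecs H" for f
    using U(2)[OF that] V(2)[OF memU[OF that]] VU[OF that] by simp
  have nV: "hnorm H (?V f) = hnorm H f" if "f \<in> vecs H" for f
    using V(2)[OF that] U(2)[OF memV[OF that]] UV[OF that] by simp
  show "unitary_operator H ?U" using U(1) nU memV VU UV by (rule unitary_operatorI)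
  show "unitary_operator H ?V" using V(1) nV memU UV VU by (rule unitary_operatorI)
qed

end

section \<open>The entries of the kernel\<close>

definition dfac :: "complex^'n \<Rightarrow> complex^'n \<Rightarrow> 'n \<Rightarrow> complex" where
  "dfac z w k = 1 - z $ k * cnj (w $ k)"

definition base_kernel :: "real^'n::finite \<Rightarrow> complex^'n \<Rightarrow> complex^'n \<Rightarrow> complex" where
  "base_kernel lam z w = (\<Prod>k\<in>UNIV. dfac z w k powr of_real (- lam $ k))"

definition jet_col :: "'n \<Rightarrow> 'n \<Rightarrow> complex^'n \<Rightarrow> complex^'n \<Rightarrow> 3 \<Rightarrow> complex" where
  "jet_col i j z w p =
     (if p = 2 then cnj (w $ i) / dfac z w i else if p = 3 then cnj (w $ j) / dfac z w j else 1)"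

lemma cnj_dfac: "cnj (dfac z w k) = dfac w z k"
  by (simp add: dfac_def mult.commute)

lemma dfac_nonzero: "z \<in> polydisc \<Longrightarrow> w \<in> polydisc \<Longrightarrow> dfac z w k \<noteq> 0"
  using norm_mult_cnj_less_1[of "z $ k" "w $ k"] by (auto simp: polydisc_def dfac_def)

lemma diag3_conj_nth:
  "(diag3 a b c ** M ** diag3 a b c ** mat d) $ p $ q =
    (if p = 2 then b else if p = 3 then c else a) * M $ p $ q
    * (if q = 2 then b else if q = 3 then c else a) * d"
  using exhaust_3[of p] exhaust_3[of q]
  by (elim disjE) (simp_all add: matrix_matrix_mult_def sum_3 diag3_def mat_def)

lemma kernelA_nth:
  assumes ij: "i \<noteq> j" and z: "z \<in> polydisc" and w: "w \<in> polydisc"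
  shows "kernelA i j lam mu z w $ p $ q = base_kernel lam z w *
    (jet_col i j z w p * cnj (jet_col i j w z q)
     + of_bool (p = 2 \<and> q = 2) * of_real (1 / lam $ i + (mu $ 1)\<^sup>2) / (dfac z w i)\<^sup>2
     + of_bool (p = 3 \<and> q = 3) * of_real (1 / lam $ j + (mu $ 2)\<^sup>2) / (dfac z w j)\<^sup>2)"
proof -
  have nz: "dfac z w k \<noteq> 0" for k by (rule dfac_nonzero[OF z w])
  have factor: "dfac z w k powr of_real (- lam $ k - 2 * of_bool (k = i) - 2 * of_bool (k = j)) =
      dfac z w k powr of_real (- lam $ k)
      * ((if k = i then 1 / (dfac z w k)\<^sup>2 else 1) * (if k = j then 1 / (dfac z w k)\<^sup>2 else 1))" for k
    using powr_neg_add_nat[OF nz[of k], of "lam $ k" 2] ij by auto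
  have c: "(\<Prod>k\<in>UNIV. dfac z w k powr of_real (- lam $ k - 2 * of_bool (k = i) - 2 * of_bool (k = j))) =
      base_kernel lam z w / ((dfac z w i)\<^sup>2 * (dfac z w j)\<^sup>2)"
    unfolding factor prod.distrib base_kernel_def by (simp add: prod.delta)
  define S where "S = base_kernel lam z w"
  define A B where "A = dfac z w i" and "B = dfac z w j"
  define a b a' b' where "a = z $ i" and "b = z $ j" and "a' = cnj (w $ i)" and "b' = cnj (w $ j)"
  define k1 k2 where "k1 = complex_of_real (1 / lam $ i + (mu $ 1)\<^sup>2)"
    and "k2 = complex_of_real (1 / lam $ j + (mu $ 2)\<^sup>2)"
  have AB: "1 - a * a' = A" "1 - b * b' = B"
    by (simp_all add: A_def B_def dfac_def a_def b_def a'_def b'_def)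
  have nzAB: "A \<noteq> 0" "B \<noteq> 0" using nz by (simp_all add: A_def B_def)
  have K: "kernelA i j lam mu z w =
     diag3 (A * B) B A ** vector [vector [1, a, b], vector [a', k1 + a * a', a' * b],
       vector [b', a * b', k2 + b * b']] ** diag3 (A * B) B A ** mat (S / (A\<^sup>2 * B\<^sup>2))"
    unfolding kernelA_def Let_def dfac_def[symmetric] c S_def[symmetric] A_def[symmetric] B_def[symmetric]
      a_def[symmetric] b_def[symmetric] a'_def[symmetric] b'_def[symmetric] k1_def[symmetric] k2_def[symmetric] AB ..
  have Q: "jet_col i j z w p = (if p = 2 then a' / A else if p = 3 then b' / B else 1)" for p
    by (simp add: jet_col_def a'_def b'_def A_def B_def)
  have P: "cnj (jet_col i j w z q) = (if q = 2 then a / A else if q = 3 then b / B else 1)" for q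
    by (simp add: jet_col_def a_def b_def A_def B_def cnj_dfac)
  have "kernelA i j lam mu z w $ p $ q = S *
    ((if p = 2 then a' / A else if p = 3 then b' / B else 1)
      * (if q = 2 then a / A else if q = 3 then b / B else 1)
     + of_bool (p = 2 \<and> q = 2) * k1 / A\<^sup>2 + of_bool (p = 3 \<and> q = 3) * k2 / B\<^sup>2)"
    using nzAB exhaust_3[of p] exhaust_3[of q] unfolding K diag3_conj_nth
    by (elim disjE) (simp_all add: divide_simps power2_eq_square mult_ac distrib_right)
  then show ?thesis unfolding Q P S_def A_def B_def k1_def k2_def .
qed

text \<open>
  Separation of variables: the jets of \<open>S\<close> are products of jets in the single variables, and a
  point carries a derivative in at most one of them. The indices \<open>2\<close> and \<open>3\<close> stand for the
  derivatives in the variables \<open>i\<close> and \<open>j\<close>.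
\<close>

lemma kernelA_nth_jet:
  fixes lam :: "real^'n::finite"
  assumes ij: "i \<noteq> j" and z: "z \<in> polydisc" and w: "w \<in> polydisc"
  shows "kernelA i j lam mu z w $ p $ q =
    (\<Prod>k\<in>UNIV - {i, j}. dfac z w k powr of_real (- lam $ k)) *
    (jet_kernel (lam $ i) (z $ i) (w $ i) (p = 2) (q = 2)
       * jet_kernel (lam $ j) (z $ j) (w $ j) (p = 3) (q = 3)
     + of_real ((mu $ 1)\<^sup>2) * (of_bool (p = 2 \<and> q = 2) * dfac z w i powr of_real (- lam $ i - 2))
        * dfac z w j powr of_real (- lam $ j)
     + of_real ((mu $ 2)\<^sup>2) * (of_bool (p = 3 \<and> q = 3) * dfac z w j powr of_real (- lam $ j - 2))
        * dfac z w i powr of_real (- lam $ i))"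
proof -
  define R where "R = (\<Prod>k\<in>UNIV - {i, j}. dfac z w k powr of_real (- lam $ k))"
  define X Y where "X = dfac z w i powr of_real (- lam $ i)" and "Y = dfac z w j powr of_real (- lam $ j)"
  have "(UNIV :: 'n set) = insert i (insert j (UNIV - {i, j}))" by auto
  then have S: "base_kernel lam z w = R * X * Y"
    unfolding base_kernel_def R_def X_def Y_def
    by (subst \<open>UNIV = _\<close>, subst prod.insert) (use ij in \<open>simp_all add: mult_ac\<close>)
  define A B where "A = dfac z w i" and "B = dfac z w j"
  have nzAB: "A \<noteq> 0" "B \<noteq> 0" using dfac_nonzero[OF z w] by (simp_all add: A_def B_def)
  have X2: "dfac z w i powr of_real (- lam $ i - 2) = X / A\<^sup>2"
    using powr_neg_add_nat[OF nzAB(1), of "lam $ i" 2] by (simp add: X_def A_def)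
  have Y2: "dfac z w j powr of_real (- lam $ j - 2) = Y / B\<^sup>2"
    using powr_neg_add_nat[OF nzAB(2), of "lam $ j" 2] by (simp add: Y_def B_def)
  have JX: "jet_kernel (lam $ i) (z $ i) (w $ i) b c = X * ((if b then cnj (w $ i) / A else 1)
      * (if c then z $ i / A else 1) + of_bool (b \<and> c) / (of_real (lam $ i) * A\<^sup>2))" for b c
    by (simp add: jet_kernel_def Let_def X_def A_def dfac_def)
  have JY: "jet_kernel (lam $ j) (z $ j) (w $ j) b c = Y * ((if b then cnj (w $ j) / B else 1)
      * (if c then z $ j / B else 1) + of_bool (b \<and> c) / (of_real (lam $ j) * B\<^sup>2))" for b c
    by (simp add: jet_kernel_def Let_def Y_def B_def dfac_def)
  have Q: "jet_col i j z w p = (if p = 2 then cnj (w $ i) / A else if p = 3 then cnj (w $ j) / B else 1)" for p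
    by (simp add: jet_col_def A_def B_def)
  have P: "cnj (jet_col i j w z q) = (if q = 2 then z $ i / A else if q = 3 then z $ j / B else 1)" for q
    by (simp add: jet_col_def A_def B_def cnj_dfac)
  have "p = 1 \<or> p = 2 \<or> p = 3" "q = 1 \<or> q = 2 \<or> q = 3" by (rule exhaust_3)+
  then show ?thesis
    unfolding kernelA_nth[OF ij z w] S R_def[symmetric] X2 Y2 X_def[symmetric] Y_def[symmetric]
    unfolding JX JY Q P A_def[symmetric] B_def[symmetric]
    by (elim disjE) (simp_all add: algebra_simps add_divide_distrib)
qed

section \<open>Boundedness of the coordinate multiplications\<close>

text \<open>
  The factor \<open>C - z\<^sub>k cnj w\<^sub>k\<close> is absorbed by the part of the kernel that depends on the \<open>k\<close>-th
  variable. For \<open>k = i\<close> this part is the jet kernel together with its \<open>\<mu>\<close>-term in one summand, and a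
  plain power in the other; for \<open>k\<close> different from \<open>i\<close> and \<open>j\<close> it is a common factor.
\<close>

lemma shift_kernelA_pos:
  fixes lam :: "real^'n::finite"
  assumes ij: "i \<noteq> j" and lam: "\<forall>k. lam $ k > 0" and mu: "mu $ 1 > 0" "mu $ 2 > 0"
  shows "\<exists>C\<ge>0. pos_kernel (polydisc \<times> UNIV) (\<lambda>x y.
    (of_real C - fst x $ k * cnj (fst y $ k)) * kernelA i j lam mu (fst x) (fst y) $ snd x $ snd y)"
proof -
  let ?Y = "polydisc \<times> (UNIV :: 3 set)"
  have h: "norm (fst x $ k) < 1" if "x \<in> ?Y" for x k
    using that by (auto simp: polydisc_def)
  define t where "t k x y = fst x $ k * cnj (fst y $ k)" for k and x y :: "(complex^'n) \<times> 3"
  define pw where "pw k x y = dfac (fst x) (fst y) k powr of_real (- lam $ k)"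
    for k and x y :: "(complex^'n) \<times> 3"
  define pw2 where "pw2 k x y = dfac (fst x) (fst y) k powr of_real (- lam $ k - 2)"
    for k and x y :: "(complex^'n) \<times> 3"
  define jk where "jk k r x y = jet_kernel (lam $ k) (fst x $ k) (fst y $ k) (snd x = r) (snd y = r)"
    for k r and x y :: "(complex^'n) \<times> 3"
  define bl where "bl r x y = (of_bool (snd x = r \<and> snd y = r) :: complex)"
    for r and x y :: "(complex^'n) \<times> 3"
  define R where "R B x y = (\<Prod>k\<in>B. pw k x y)" for B x y
  have s: "lam $ k > 0" for k using lam by blast
  have S_pw: "schur_factor ?Y (pw k)" for k
    unfolding pw_def dfac_def using schur_factor_powr[OF h s] .
  have "- (lam $ k + 2) = - lam $ k - 2" for k by simp
  then have S_pw2: "schur_factor ?Y (pw2 k)" for k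
    using schur_factor_powr[OF h, of ?Y _ "lam $ k + 2"] s[of k] unfolding pw2_def dfac_def by simp
  have S_jk: "schur_factor ?Y (jk k r)" for k r
    unfolding jk_def using schur_factor_jet_kernel[OF h s] .
  have S_R: "schur_factor ?Y (R B)" for B
    unfolding R_def by (intro schur_factor_prod S_pw)
  have S_bl: "schur_factor ?Y (bl r)" for r
    unfolding bl_def by (rule schur_factor_of_bool)
  have S_m: "schur_factor ?Y (\<lambda>x y. of_real (m\<^sup>2))" for m
    by (rule schur_factor_const) simp
  \<comment> \<open>large enough for both summands in each variable, whichever of the two \<open>\<mu>\<close>-terms belongs to it\<close>
  define C where "C = Max (range (\<lambda>k. 2 * (1 + 1 / lam $ k)
      + 2 / ((mu $ 1)\<^sup>2 * (lam $ k)\<^sup>2) + 2 / ((mu $ 2)\<^sup>2 * (lam $ k)\<^sup>2)))"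
  have C_ge: "C \<ge> 2 * (1 + 1 / lam $ k)
      + 2 / ((mu $ 1)\<^sup>2 * (lam $ k)\<^sup>2) + 2 / ((mu $ 2)\<^sup>2 * (lam $ k)\<^sup>2)" for k
    unfolding C_def by (intro Max_ge) auto
  have nonneg: "2 / ((mu $ 1)\<^sup>2 * (lam $ k)\<^sup>2) \<ge> 0" "2 / ((mu $ 2)\<^sup>2 * (lam $ k)\<^sup>2) \<ge> 0"
    "1 / lam $ k > 0" for k using s[of k] by simp_all
  have C: "C \<ge> 2 * (1 + 1 / lam $ k)" "C \<ge> 1 + 1 / lam $ k" "C \<ge> 0"
    "C \<ge> 1 + 2 / ((mu $ 1)\<^sup>2 * (lam $ k)\<^sup>2)" "C \<ge> 1 + 2 / ((mu $ 2)\<^sup>2 * (lam $ k)\<^sup>2)" for k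
    using C_ge[of k] nonneg[of k] unfolding distrib_left by linarith+
  have S_shift: "schur_factor ?Y (\<lambda>x y. (of_real C - t k x y) * pw k x y)" for k
    unfolding t_def pw_def dfac_def by (rule schur_factor_shift_powr[OF h s C(2)])
  have S_shift1: "schur_factor ?Y (\<lambda>x y. (of_real C - t k x y) *
      (jk k r x y + of_real ((mu $ 1)\<^sup>2) * (bl r x y * pw2 k x y)))" for k r
    unfolding t_def pw2_def jk_def bl_def dfac_def
    using mu by (intro schur_factor_shift_jet[OF h s _ C(1) C(4)]) auto
  have S_shift2: "schur_factor ?Y (\<lambda>x y. (of_real C - t k x y) *
      (jk k r x y + of_real ((mu $ 2)\<^sup>2) * (bl r x y * pw2 k x y)))" for k r
    unfolding t_def pw2_def jk_def bl_def dfac_def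
    using mu by (intro schur_factor_shift_jet[OF h s _ C(1) C(5)]) auto
  have bl2: "bl 2 x y * jk j 3 x y = bl 2 x y * pw j x y" for x y
    by (auto simp: bl_def jk_def pw_def jet_kernel_def Let_def dfac_def)
  have bl3: "bl 3 x y * jk i 2 x y = bl 3 x y * pw i x y" for x y
    by (auto simp: bl_def jk_def pw_def jet_kernel_def Let_def dfac_def)
  define core where "core x y = jk i 2 x y * jk j 3 x y
      + of_real ((mu $ 1)\<^sup>2) * (bl 2 x y * pw2 i x y) * pw j x y
      + of_real ((mu $ 2)\<^sup>2) * (bl 3 x y * pw2 j x y) * pw i x y" for x y
  have S_core: "schur_factor ?Y core"
    unfolding core_def by (intro schur_factor_add schur_factor_mult S_jk S_pw S_pw2 S_bl S_m)
  have K: "kernelA i j lam mu (fst x) (fst y) $ snd x $ snd y = R (UNIV - {i, j}) x y * core x y"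
    if "x \<in> ?Y" "y \<in> ?Y" for x y
    using that kernelA_nth_jet[OF ij, of "fst x" "fst y" lam mu "snd x" "snd y"]
    by (auto simp: R_def core_def jk_def pw_def pw2_def bl_def)
  have "schur_factor ?Y (\<lambda>x y. (of_real C - t k x y) * (R (UNIV - {i, j}) x y * core x y))"
  proof -
    consider "k = i" | "k = j" | "k \<noteq> i" "k \<noteq> j" by blast
    then show ?thesis
    proof cases
      case 1
      have "schur_factor ?Y (\<lambda>x y. R (UNIV - {i, j}) x y *
          (((of_real C - t i x y) * (jk i 2 x y + of_real ((mu $ 1)\<^sup>2) * (bl 2 x y * pw2 i x y))) * jk j 3 x y
          + (of_real ((mu $ 2)\<^sup>2) * (bl 3 x y * pw2 j x y)) * ((of_real C - t i x y) * pw i x y)))"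
        by (intro schur_factor_mult[OF S_R] schur_factor_add schur_factor_mult[OF S_shift1 S_jk]
            schur_factor_mult[OF _ S_shift] schur_factor_mult[OF S_m] schur_factor_mult[OF S_bl S_pw2])
      then show ?thesis
      proof (rule schur_factor_cong)
        fix x y
        have "bl 2 x y * pw2 i x y * jk j 3 x y = bl 2 x y * pw2 i x y * pw j x y"
          using bl2[of x y] by (simp add: mult_ac)
        then show "(of_real C - t k x y) * (R (UNIV - {i, j}) x y * core x y) =
          R (UNIV - {i, j}) x y *
          (((of_real C - t i x y) * (jk i 2 x y + of_real ((mu $ 1)\<^sup>2) * (bl 2 x y * pw2 i x y))) * jk j 3 x y
          + (of_real ((mu $ 2)\<^sup>2) * (bl 3 x y * pw2 j x y)) * ((of_real C - t i x y) * pw i x y))"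
          unfolding 1 core_def by algebra
      qed
    next
      case 2
      have "schur_factor ?Y (\<lambda>x y. R (UNIV - {i, j}) x y *
          (((of_real C - t j x y) * (jk j 3 x y + of_real ((mu $ 2)\<^sup>2) * (bl 3 x y * pw2 j x y))) * jk i 2 x y
          + (of_real ((mu $ 1)\<^sup>2) * (bl 2 x y * pw2 i x y)) * ((of_real C - t j x y) * pw j x y)))"
        by (intro schur_factor_mult[OF S_R] schur_factor_add schur_factor_mult[OF S_shift2 S_jk]
            schur_factor_mult[OF _ S_shift] schur_factor_mult[OF S_m] schur_factor_mult[OF S_bl S_pw2])
      then show ?thesis
      proof (rule schur_factor_cong)
        fix x y
        have "bl 3 x y * pw2 j x y * jk i 2 x y = bl 3 x y * pw2 j x y * pw i x y"
          using bl3[of x y] by (simp add: mult_ac)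
        then show "(of_real C - t k x y) * (R (UNIV - {i, j}) x y * core x y) =
          R (UNIV - {i, j}) x y *
          (((of_real C - t j x y) * (jk j 3 x y + of_real ((mu $ 2)\<^sup>2) * (bl 3 x y * pw2 j x y))) * jk i 2 x y
          + (of_real ((mu $ 1)\<^sup>2) * (bl 2 x y * pw2 i x y)) * ((of_real C - t j x y) * pw j x y))"
          unfolding 2 core_def by algebra
      qed
    next
      case 3
      have "schur_factor ?Y (\<lambda>x y. ((of_real C - t k x y) * pw k x y) * (R (UNIV - {i, j} - {k}) x y * core x y))"
        by (intro schur_factor_mult[OF S_shift] schur_factor_mult[OF S_R S_core])
      moreover have "R (UNIV - {i, j}) x y = pw k x y * R (UNIV - {i, j} - {k}) x y" for x y
        unfolding R_def using 3 by (intro prod.remove) auto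
      ultimately show ?thesis by (simp add: mult.assoc)
    qed
  qed
  from schur_factor_imp_pos_kernel[OF this]
  have "pos_kernel ?Y (\<lambda>x y. (of_real C - fst x $ k * cnj (fst y $ k))
      * kernelA i j lam mu (fst x) (fst y) $ snd x $ snd y)"
    by (rule pos_kernel_cong) (simp only: K t_def)
  with C(3) show ?thesis by blast
qed

section \<open>Disc automorphisms\<close>

definition moeb_map :: "complex \<Rightarrow> complex \<Rightarrow> complex \<Rightarrow> complex" where
  "moeb_map u a z = u * (z - a) / (1 - cnj a * z)"

text \<open>
  With \<open>a\<close> the zero of \<open>g\<close>, precomposition with the automorphism taking \<open>0\<close> to \<open>a\<close> gives an
  automorphism fixing \<open>0\<close>. Its inverse fixes \<open>0\<close> too, so the Schwarz lemma applies to both and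
  equality holds.
\<close>

lemma moeb_normal_form:
  assumes "g \<in> moeb"
  obtains u a where "norm u = 1" "norm a < 1" "\<And>z. norm z < 1 \<Longrightarrow> g z = moeb_map u a z"
proof -
  obtain h where g: "g holomorphic_on ball 0 1" "g ` ball 0 1 \<subseteq> ball 0 1"
    and h: "h holomorphic_on ball 0 1" "h ` ball 0 1 \<subseteq> ball 0 1"
    and inv: "\<And>z. z \<in> ball 0 1 \<Longrightarrow> h (g z) = z" "\<And>z. z \<in> ball 0 1 \<Longrightarrow> g (h z) = z"
    using assms unfolding moeb_def by blast
  define a where "a = h 0"
  have a: "norm a < 1" using h(2) by (simp add: a_def image_subset_iff)
  have ma: "norm (- a) < 1" using a by simp
  let ?M = "Moebius_function 0 a" and ?N = "Moebius_function 0 (- a)"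
  have M: "?M ` ball 0 1 \<subseteq> ball 0 1" and N: "?N ` ball 0 1 \<subseteq> ball 0 1"
    using Moebius_function_norm_lt_1[OF a] Moebius_function_norm_lt_1[OF ma] by auto
  have NM: "?N (?M z) = z" if "norm z < 1" for z
    using Moebius_function_compose[of "- a" a z] ma that by simp
  have MN: "?M (?N z) = z" if "norm z < 1" for z
    using Moebius_function_compose[of a "- a" z] a that by simp
  define f where "f = g \<circ> ?N"
  define k where "k = ?M \<circ> h"
  have f_hol: "f holomorphic_on ball 0 1"
    unfolding f_def
    by (rule holomorphic_on_compose_gen[OF Moebius_function_holomorphic[OF ma] g(1) N])
  have k_hol: "k holomorphic_on ball 0 1"
    unfolding k_def
    by (rule holomorphic_on_compose_gen[OF h(1) Moebius_function_holomorphic[OF a] h(2)])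
  have f_lt: "norm (f z) < 1" if "norm z < 1" for z using that g(2) N by (simp add: f_def image_subset_iff)
  have k_lt: "norm (k z) < 1" if "norm z < 1" for z using that h(2) M by (simp add: k_def image_subset_iff)
  have f0: "f 0 = 0" using inv(2)[of 0] by (simp add: f_def Moebius_function_of_zero a_def)
  have k0: "k 0 = 0" by (simp add: k_def a_def[symmetric] Moebius_function_eq_zero)
  have kf: "k (f z) = z" if "norm z < 1" for z
  proof -
    have "?N z \<in> ball 0 1" using N that by (simp add: image_subset_iff)
    then show ?thesis using inv(1) MN[OF that] by (simp add: k_def f_def)
  qed
  have half: "norm (1/2 :: complex) < 1" by simp
  have "norm (f (1/2)) \<le> norm (1/2 :: complex)"
    by (rule Schwarz_Lemma(1)[OF f_hol f0 f_lt half])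
  moreover have "norm (k (f (1/2))) \<le> norm (f (1/2))"
    by (rule Schwarz_Lemma(1)[OF k_hol k0 k_lt f_lt[OF half]])
  ultimately have "norm (f (1/2)) = norm (1/2 :: complex)" by (simp add: kf)
  then have "(\<exists>z. norm z < 1 \<and> z \<noteq> 0 \<and> norm (f z) = norm z) \<or> norm (deriv f 0) = 1"
    by (intro disjI1 exI[of _ "1/2"]) simp
  then obtain u where u: "\<And>z. norm z < 1 \<Longrightarrow> f z = u * z" "norm u = 1"
    using Schwarz_Lemma(3)[OF f_hol f0 f_lt half] by blast
  have "g z = moeb_map u a z" if "norm z < 1" for z
  proof -
    have "norm (?M z) < 1" using M that by (simp add: image_subset_iff)
    then have "g z = u * ?M z" using u(1)[of "?M z"] NM[OF that] by (simp add: f_def)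
    then show ?thesis by (simp add: moeb_map_def Moebius_function_simple)
  qed
  then show ?thesis using that u(2) a by blast
qed

lemma Re_one_minus_pos: "norm z < 1 \<Longrightarrow> Re (1 - z) > 0"
  using complex_Re_le_cmod[of z] by simp

text \<open>The arguments lie in \<open>(-\<pi>/2, \<pi>/2)\<close>, so the principal logarithms add without a jump.\<close>

lemma powr_mult_Re_pos:
  assumes "Re x > 0" "Re y > 0" shows "(x * y) powr s = x powr s * y powr s"
proof -
  have nz: "x \<noteq> 0" "y \<noteq> 0" using assms by auto
  have "\<bar>Im (Ln x)\<bar> < pi / 2" "\<bar>Im (Ln y)\<bar> < pi / 2"
    using Re_Ln_pos_lt[OF nz(1)] Re_Ln_pos_lt[OF nz(2)] assms by blast+
  then have "Ln (x * y) = Ln x + Ln y" using nz by (intro Ln_times_simple) linarith+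
  then show ?thesis using nz by (simp add: powr_def distrib_left exp_add)
qed

lemma powr_inverse_Re_pos:
  assumes "Re x > 0" shows "inverse x powr s = inverse (x powr s)"
proof -
  have "x \<noteq> 0" using assms by auto
  then have "Re (inverse x) > 0" using assms by (simp add: Re_complex_div_gt_0 inverse_eq_divide)
  from powr_mult_Re_pos[OF assms this, of s] \<open>x \<noteq> 0\<close> have "x powr s * inverse x powr s = 1" by simp
  then show ?thesis by (metis inverse_unique)
qed

text \<open>
  Up to a unimodular constant, \<open>moeb_weight s a\<close> is the power \<open>s / 2\<close> of the derivative
  \<open>moeb_deriv u a\<close> of \<open>moeb_map u a\<close>, written so that only a power of a number with positive real
  part occurs. Its logarithmic derivative is \<open>s\<close> times \<open>moeb_logderiv a\<close>.
\<close>

definition moeb_weight :: "real \<Rightarrow> complex \<Rightarrow> complex \<Rightarrow> complex" where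
  "moeb_weight s a z = of_real ((1 - (cmod a)\<^sup>2) powr (s / 2)) * (1 - cnj a * z) powr of_real (- s)"

definition moeb_deriv :: "complex \<Rightarrow> complex \<Rightarrow> complex \<Rightarrow> complex" where
  "moeb_deriv u a z = u * of_real (1 - (cmod a)\<^sup>2) / (1 - cnj a * z)\<^sup>2"

definition moeb_logderiv :: "complex \<Rightarrow> complex \<Rightarrow> complex" where
  "moeb_logderiv a z = cnj a / (1 - cnj a * z)"

lemma moeb_denom:
  assumes a: "norm a < 1" and z: "norm z < 1" and w: "norm w < 1"
  shows "1 - cnj a * z \<noteq> 0" "1 - a * cnj w \<noteq> 0" "1 - z * cnj w \<noteq> 0"
    "Re (1 - cnj a * z) > 0" "Re (1 - a * cnj w) > 0" "Re (1 - z * cnj w) > 0"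
proof -
  have lt: "norm (cnj a * z) < 1" "norm (a * cnj w) < 1" "norm (z * cnj w) < 1"
    using norm_mult_cnj_less_1[OF z a] norm_mult_cnj_less_1[OF a w] norm_mult_cnj_less_1[OF z w]
    by (simp_all add: mult.commute)
  from lt[THEN Re_one_minus_pos]
  show "Re (1 - cnj a * z) > 0" "Re (1 - a * cnj w) > 0" "Re (1 - z * cnj w) > 0" .
  then show "1 - cnj a * z \<noteq> 0" "1 - a * cnj w \<noteq> 0" "1 - z * cnj w \<noteq> 0"
    by (metis less_irrefl zero_complex.sel(1))+
qed

lemma of_real_one_minus_norm_sq: "complex_of_real (1 - (cmod a)\<^sup>2) = 1 - a * cnj a"
  by (simp add: complex_norm_square[symmetric])

lemma one_minus_norm_sq_pos: "norm a < 1 \<Longrightarrow> 1 - (cmod a)\<^sup>2 > 0"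
  by (simp add: power_less_one_iff abs_square_less_1)

lemma one_minus_norm_sq_nonzero: "norm a < 1 \<Longrightarrow> 1 - a * cnj a \<noteq> 0"
  using of_real_one_minus_norm_sq[of a] one_minus_norm_sq_pos[of a]
  by (metis of_real_eq_0_iff less_irrefl)

lemma unimodular_mult_cnj: "norm u = 1 \<Longrightarrow> u * cnj u = 1"
  by (simp add: complex_norm_square[symmetric])

context
  fixes u a z w :: complex
  assumes u: "norm u = 1" and a: "norm a < 1" and z: "norm z < 1" and w: "norm w < 1"
begin

lemma moeb_map_cofactor:
  "(1 - moeb_map u a z * cnj (moeb_map u a w)) * ((1 - cnj a * z) * (1 - a * cnj w)) =
    (1 - a * cnj a) * (1 - z * cnj w)"
proof -
  have "moeb_map u a z * cnj (moeb_map u a w) * ((1 - cnj a * z) * (1 - a * cnj w)) =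
      (u * cnj u) * ((z - a) * (cnj w - cnj a))"
    using moeb_denom[OF a z w] by (simp add: moeb_map_def)
  then show ?thesis by (simp add: unimodular_mult_cnj[OF u] algebra_simps)
qed

lemma moeb_map_cofactor_eq:
  "1 - moeb_map u a z * cnj (moeb_map u a w) =
    (1 - a * cnj a) * (1 - z * cnj w) / ((1 - cnj a * z) * (1 - a * cnj w))"
  using moeb_denom(1,2)[OF a z w] by (intro nonzero_eq_divide_eq[THEN iffD2, OF _ moeb_map_cofactor]) simp

text \<open>
  The logarithmic derivative of the rule for \<open>1 - z cnj w\<close> with respect to \<open>z\<close>: the chain rule for
  the derivative slot of a jet.
\<close>

lemma moeb_jet_col:
  "cnj w / (1 - z * cnj w) = moeb_logderiv a z
     + moeb_deriv u a z * (cnj (moeb_map u a w) / (1 - moeb_map u a z * cnj (moeb_map u a w)))"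
proof -
  define A x y e where "A = 1 - z * cnj w" and "x = 1 - cnj a * z" and "y = 1 - a * cnj w"
    and "e = 1 - a * cnj a"
  have nz: "A \<noteq> 0" "x \<noteq> 0" "y \<noteq> 0" "e \<noteq> 0"
    using moeb_denom[OF a z w] one_minus_norm_sq_nonzero[OF a] unfolding A_def x_def y_def e_def by blast+
  have A': "1 - moeb_map u a z * cnj (moeb_map u a w) = e * A / (x * y)"
    unfolding A_def x_def y_def e_def by (rule moeb_map_cofactor_eq)
  have "moeb_deriv u a z * (cnj (moeb_map u a w) / (e * A / (x * y))) = 
      (u * cnj u) * ((cnj w - cnj a) / (x * A))"
    using nz unfolding moeb_deriv_def of_real_one_minus_norm_sq moeb_map_def
    by (simp add: x_def[symmetric] e_def[symmetric] y_def[symmetric] power2_eq_square divide_simps)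
  moreover have "cnj w / A = cnj a / x + (cnj w - cnj a) / (x * A)"
    using nz by (simp add: divide_simps) (simp add: A_def x_def algebra_simps)
  ultimately show ?thesis
    unfolding A' by (simp add: A_def x_def moeb_logderiv_def unimodular_mult_cnj[OF u])
qed

lemma moeb_deriv_cofactor:
  "1 / (1 - z * cnj w)\<^sup>2 = moeb_deriv u a z * cnj (moeb_deriv u a w)
     / (1 - moeb_map u a z * cnj (moeb_map u a w))\<^sup>2"
proof -
  define A x y e where "A = 1 - z * cnj w" and "x = 1 - cnj a * z" and "y = 1 - a * cnj w"
    and "e = 1 - a * cnj a"
  have nz: "A \<noteq> 0" "x \<noteq> 0" "y \<noteq> 0" "e \<noteq> 0"
    using moeb_denom[OF a z w] one_minus_norm_sq_nonzero[OF a] unfolding A_def x_def y_def e_def by blast+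
  have A': "1 - moeb_map u a z * cnj (moeb_map u a w) = e * A / (x * y)"
    unfolding A_def x_def y_def e_def by (rule moeb_map_cofactor_eq)
  have "moeb_deriv u a z * cnj (moeb_deriv u a w) = (u * cnj u) * (e\<^sup>2 / (x\<^sup>2 * y\<^sup>2))"
    unfolding moeb_deriv_def of_real_one_minus_norm_sq
    by (simp add: x_def y_def e_def power2_eq_square mult_ac)
  then show ?thesis
    unfolding A' using nz by (simp add: A_def[symmetric] unimodular_mult_cnj[OF u] power_divide power_mult_distrib)
qed

text \<open>
  Raise \<open>moeb_map_cofactor\<close> to the power \<open>-s\<close>. One factor is first moved to the other side as an
  inverse, so that each side is a product of two numbers with positive real part.
\<close>

lemma moeb_weight_cofactor:
  "(1 - z * cnj w) powr of_real (- s) = moeb_weight s a z * cnj (moeb_weight s a w)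
     * (1 - moeb_map u a z * cnj (moeb_map u a w)) powr of_real (- s)"
proof -
  define e where "e = 1 - (cmod a)\<^sup>2"
  have e: "e > 0" "complex_of_real e = 1 - a * cnj a" using one_minus_norm_sq_pos[OF a] of_real_one_minus_norm_sq[of a] by (simp_all add: e_def)
  let ?A = "1 - z * cnj w" and ?B = "1 - moeb_map u a z * cnj (moeb_map u a w)"
  let ?x = "1 - cnj a * z" and ?y = "1 - a * cnj w"
  have eq: "of_real e * ?A * inverse ?x = ?B * ?y"
    using moeb_denom(1,2)[OF a z w] unfolding moeb_map_cofactor_eq e(2) by (simp add: divide_simps)
  have lt: "norm (moeb_map u a v) < 1" if "norm v < 1" for v
    using Moebius_function_norm_lt_1[OF a that, of 0] u
    by (simp add: moeb_map_def Moebius_function_def norm_mult norm_divide)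
  have ReB: "Re ?B > 0"
    by (rule Re_one_minus_pos[OF norm_mult_cnj_less_1[OF lt[OF z] lt[OF w]]])
  have Rex: "Re (inverse ?x) > 0"
    using moeb_denom(1,4)[OF a z w] by (simp add: Re_complex_div_gt_0 inverse_eq_divide)
  have ReA: "Re (of_real e * ?A) > 0" using moeb_denom(6)[OF a z w] e(1) by simp
  let ?s = "complex_of_real (- s)"
  have "of_real e powr ?s * ?A powr ?s * inverse (?x powr ?s) = ?B powr ?s * ?y powr ?s"
    using arg_cong[OF eq, of "\<lambda>v. v powr ?s"] e(1)
      powr_mult_Re_pos[OF ReA Rex, of ?s] powr_mult_Re_pos[OF ReB moeb_denom(5)[OF a z w], of ?s]
      powr_mult_Re_pos[OF _ moeb_denom(6)[OF a z w], of "of_real e" ?s] powr_inverse_Re_pos[OF moeb_denom(4)[OF a z w], of ?s]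
    by simp
  moreover have "?x powr ?s \<noteq> 0" using moeb_denom(1)[OF a z w] by simp
  ultimately have 1: "of_real e powr ?s * ?A powr ?s = ?x powr ?s * ?y powr ?s * ?B powr ?s"
    by (simp add: field_simps)
  have 2: "of_real (e powr (s / 2)) * of_real (e powr (s / 2)) * (of_real e powr ?s) = (1 :: complex)"
  proof -
    have "e powr (s / 2) * e powr (s / 2) * e powr (- s) = 1"
      using e(1) by (simp flip: powr_add)
    moreover have "of_real e powr ?s = complex_of_real (e powr (- s))"
      using e(1) by (intro powr_of_real) simp
    ultimately show ?thesis by (simp only: of_real_mult[symmetric] of_real_1)
  qed
  have "Re (1 - cnj a * w) \<ge> 0" using moeb_denom(5)[OF a z w] by simp
  then have 3: "cnj ((1 - cnj a * w) powr ?s) = ?y powr ?s" by (simp add: cnj_powr)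
  have "?A powr ?s = (of_real (e powr (s / 2)) * of_real (e powr (s / 2)) * (of_real e powr ?s)) * ?A powr ?s"
    unfolding 2 by simp
  also have "\<dots> = of_real (e powr (s / 2)) * of_real (e powr (s / 2)) * (?x powr ?s * ?y powr ?s * ?B powr ?s)"
    unfolding 1[symmetric] by (simp only: mult.assoc)
  finally show ?thesis
    unfolding moeb_weight_def e_def[symmetric] complex_cnj_mult[of "of_real _"] 3 complex_cnj_complex_of_real
    by (simp only: mult_ac)
qed

end

section \<open>Exactness of the Koszul complex\<close>

text \<open>This makes insertion of \<open>k\<close> as first index a homotopy between \<open>T k\<close> and zero.\<close>

lemma koszul_d_Cons:
  "koszul_d T \<xi> (k # ks) = T k (\<xi> ks) - koszul_d T (\<lambda>js. \<xi> (k # js)) ks"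
proof -
  let ?f = "\<lambda>l. let y = T ((k # ks) ! l) (\<xi> (take l (k # ks) @ drop (Suc l) (k # ks)))
                in if even l then y else - y"
  have "koszul_d T \<xi> (k # ks) = (\<Sum>l<Suc (length ks). ?f l)"
    by (simp add: koszul_d_def)
  also have "\<dots> = ?f 0 + (\<Sum>l<length ks. ?f (Suc l))"
    by (rule sum.lessThan_Suc_shift)
  also have "(\<Sum>l<length ks. ?f (Suc l)) = - koszul_d T (\<lambda>js. \<xi> (k # js)) ks"
    by (simp add: koszul_d_def Let_def if_distrib flip: sum_negf cong: if_cong)
      (intro sum.cong refl; simp)
  finally show ?thesis by simp
qed

context chilbert_space
begin

context
  fixes R assumes R: "linear_operator H R"
begin

lemma linear_operator_mem: "x \<in> vecs H \<Longrightarrow> R x \<in> vecs H"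
  using R by (auto simp: linear_operator_def)

lemma linear_operator_0: "R 0 = 0"
proof -
  have "R (0 + 0) = R 0 + R 0" using R zero_mem unfolding linear_operator_def by blast
  then show ?thesis by simp
qed

lemma linear_operator_minus:
  assumes "x \<in> vecs H" shows "R (- x) = - R x"
proof -
  have "R (x + - x) = R x + R (- x)"
    using R assms minus_mem[OF assms] unfolding linear_operator_def by blast
  then show ?thesis by (simp add: linear_operator_0 eq_neg_iff_add_eq_0 add.commute)
qed

lemma linear_operator_sum:
  "(\<And>l. l \<in> A \<Longrightarrow> h l \<in> vecs H) \<Longrightarrow> R (sum h A) = (\<Sum>l\<in>A. R (h l))"
proof (induction A rule: infinite_finite_induct)
  case (insert a A)
  have "R (h a + sum h A) = R (h a) + R (sum h A)"
    using R insert.prems sum_mem[of A h] unfolding linear_operator_def by blast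
  with insert show ?case by simp
qed (simp_all add: linear_operator_0)

end

lemma linear_operator_koszul_d:
  assumes R: "linear_operator H R" and B: "\<And>i. linear_operator H (B i)"
    and comm: "\<And>i x. x \<in> vecs H \<Longrightarrow> R (B i x) = B i (R x)"
    and \<zeta>: "\<And>js. \<zeta> js \<in> vecs H"
  shows "R (koszul_d B \<zeta> ks) = koszul_d B (\<lambda>js. R (\<zeta> js)) ks"
proof -
  let ?y = "\<lambda>l. B (ks ! l) (\<zeta> (take l ks @ drop (Suc l) ks))"
  have y: "?y l \<in> vecs H" for l by (intro linear_operator_mem[OF B] \<zeta>)
  have "R (koszul_d B \<zeta> ks) = (\<Sum>l<length ks. R (if even l then ?y l else - ?y l))"
    unfolding koszul_d_def Let_def using y by (intro linear_operator_sum[OF R]) (simp add: minus_mem)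
  also have "\<dots> = koszul_d B (\<lambda>js. R (\<zeta> js)) ks"
    unfolding koszul_d_def Let_def using y
    by (intro sum.cong refl) (simp add: linear_operator_minus[OF R] comm \<zeta>)
  finally show ?thesis .
qed

text \<open>
  As \<open>R\<close> commutes with the differential, applying it to \<open>koszul_d_Cons\<close> shows that
  \<open>\<lambda>js. R (\<xi> (k # js))\<close> is a primitive of a cocycle \<open>\<xi>\<close>.
\<close>

lemma koszul_exact_if_invertible:
  assumes B: "\<And>i. linear_operator H (B i)" and R: "linear_operator H R"
    and inv: "\<And>x. x \<in> vecs H \<Longrightarrow> R (B k x) = x"
    and comm: "\<And>i x. x \<in> vecs H \<Longrightarrow> R (B i x) = B i (R x)"
  shows "koszul_exact H B"
proof -
  have mem: "\<xi> js \<in> vecs H" if "\<xi> \<in> koszul_cochains H p" for \<xi> p js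
    using that zero_mem by (cases "length js = p") (auto simp: koszul_cochains_def)
  have homotopy: "\<xi> ks = koszul_d B (\<lambda>js. R (\<xi> (k # js))) ks"
    if \<xi>: "\<xi> \<in> koszul_cochains H p" and "koszul_d B \<xi> = (\<lambda>_. 0)" for \<xi> p ks
  proof -
    have "B k (\<xi> ks) - koszul_d B (\<lambda>js. \<xi> (k # js)) ks = 0"
      using koszul_d_Cons[of B \<xi> k ks] that(2) by simp
    then have "R (B k (\<xi> ks)) = R (koszul_d B (\<lambda>js. \<xi> (k # js)) ks)" by simp
    then show ?thesis
      by (simp add: inv mem[OF \<xi>] linear_operator_koszul_d[OF R B comm])
  qed
  have "\<xi> = (\<lambda>_. 0)" if \<xi>: "\<xi> \<in> koszul_cochains H 0" "koszul_d B \<xi> = (\<lambda>_. 0)" for \<xi>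
  proof
    fix ks show "\<xi> ks = 0"
      using homotopy[OF \<xi>, of "[]"] \<xi>(1)
      by (cases ks) (simp_all add: koszul_d_def koszul_cochains_def)
  qed
  moreover have "\<exists>\<eta>\<in>koszul_cochains H p. \<xi> = koszul_d B \<eta>"
    if \<xi>: "\<xi> \<in> koszul_cochains H (Suc p)" "koszul_d B \<xi> = (\<lambda>_. 0)" for \<xi> p
  proof
    show "\<xi> = koszul_d B (\<lambda>js. R (\<xi> (k # js)))" using homotopy[OF \<xi>] by blast
    have alt: "R (\<xi> (k # as @ a # b # bs)) = - R (\<xi> (k # as @ b # a # bs))" for as a b bs
    proof -
      have "\<xi> ((k # as) @ a # b # bs) = - \<xi> ((k # as) @ b # a # bs)"
        using \<xi>(1) unfolding koszul_cochains_def by blast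
      then have "R (\<xi> (k # as @ a # b # bs)) = R (- \<xi> (k # as @ b # a # bs))"
        unfolding append_Cons by (rule arg_cong)
      also have "\<dots> = - R (\<xi> (k # as @ b # a # bs))"
        by (rule linear_operator_minus[OF R mem[OF \<xi>(1)]])
      finally show ?thesis .
    qed
    have zero: "R (\<xi> (k # js)) = 0" if "length js \<noteq> p" for js
      using \<xi>(1) that linear_operator_0[OF R] by (simp add: koszul_cochains_def)
    show "(\<lambda>js. R (\<xi> (k # js))) \<in> koszul_cochains H p"
      unfolding koszul_cochains_def mem_Collect_eq
      by (intro conjI allI impI alt zero linear_operator_mem[OF R mem[OF \<xi>(1)]])
  qed
  ultimately show ?thesis by (simp add: koszul_exact_def)
qed

end

section \<open>Quasi-invariance of the kernel\<close>

definition moeb_poly :: "('n \<Rightarrow> complex) \<Rightarrow> ('n \<Rightarrow> complex) \<Rightarrow> complex^'n \<Rightarrow> complex^'n" where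
  "moeb_poly u a z = (\<chi> k. moeb_map (u k) (a k) (z $ k))"

text \<open>
  The shape of \<open>J\<close>: the first component of a jet is multiplied by \<open>m\<close>, and by the product rule each
  derivative slot receives \<open>m\<close> times a multiple \<open>d\<close> of itself and a multiple \<open>c\<close> of the first
  component.
\<close>

definition lower3 :: "complex \<Rightarrow> complex \<Rightarrow> complex \<Rightarrow> complex \<Rightarrow> complex \<Rightarrow> complex^3^3" where
  "lower3 m c d c' d' = vector [vector [m, 0, 0], vector [m * c, m * d, 0], vector [m * c', 0, m * d']]"

definition moeb_cocycle ::
  "'n::finite \<Rightarrow> 'n \<Rightarrow> real^'n \<Rightarrow> ('n \<Rightarrow> complex) \<Rightarrow> ('n \<Rightarrow> complex) \<Rightarrow> complex^'n \<Rightarrow> complex^3^3" where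
  "moeb_cocycle i j lam u a z =
     lower3 (\<Prod>k\<in>UNIV. moeb_weight (lam $ k) (a k) (z $ k))
       (moeb_logderiv (a i) (z $ i)) (moeb_deriv (u i) (a i) (z $ i))
       (moeb_logderiv (a j) (z $ j)) (moeb_deriv (u j) (a j) (z $ j))"

lemma lower3_conj_nth:
  fixes K :: "complex^3^3"
  assumes K: "\<And>r s. K $ r $ s = S * (Q r * P s + of_bool (r = 2 \<and> s = 2) * X + of_bool (r = 3 \<and> s = 3) * Y)"
    and 1: "Q 1 = 1" "P 1 = 1"
  shows "(lower3 m c d c' d' ** K ** adj_mat (lower3 n e f e' f')) $ p $ q = m * cnj n * S *
    ((if p = 2 then c + d * Q 2 else if p = 3 then c' + d' * Q 3 else 1)
      * (if q = 2 then cnj e + cnj f * P 2 else if q = 3 then cnj e' + cnj f' * P 3 else 1)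
     + of_bool (p = 2 \<and> q = 2) * (d * cnj f * X) + of_bool (p = 3 \<and> q = 3) * (d' * cnj f' * Y))"
  using exhaust_3[of p] exhaust_3[of q]
  by (elim disjE)
    (simp_all add: matrix_matrix_mult_def sum_3 lower3_def adj_mat_def K 1 algebra_simps)

text \<open>
  \<open>J z\<close> maps the column \<open>Q\<close> at \<open>(\<psi> z, \<psi> w)\<close> to \<open>m\<close> times the column \<open>Q\<close> at \<open>(z, w)\<close>, and rescales
  the diagonal part by the derivatives of \<open>\<psi>\<close>; both effects are the transformation rules in one
  variable.
\<close>

lemma kernelA_quasi_invariant:
  assumes ij: "i \<noteq> j" and u: "\<And>k. norm (u k) = 1" and a: "\<And>k. norm (a k) < 1"
    and z: "z \<in> polydisc" and w: "w \<in> polydisc"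
    and \<psi>z: "moeb_poly u a z \<in> polydisc" and \<psi>w: "moeb_poly u a w \<in> polydisc"
  shows "kernelA i j lam mu z w = moeb_cocycle i j lam u a z
    ** kernelA i j lam mu (moeb_poly u a z) (moeb_poly u a w) ** adj_mat (moeb_cocycle i j lam u a w)"
proof -
  let ?\<psi> = "moeb_poly u a"
  have zk: "norm (z $ k) < 1" and wk: "norm (w $ k) < 1" for k
    using z w by (simp_all add: polydisc_def)
  have df: "dfac (?\<psi> z) (?\<psi> w) k = 1 - moeb_map (u k) (a k) (z $ k) * cnj (moeb_map (u k) (a k) (w $ k))" for k
    by (simp add: dfac_def moeb_poly_def)
  have S: "base_kernel lam z w = (\<Prod>k\<in>UNIV. moeb_weight (lam $ k) (a k) (z $ k))
      * cnj (\<Prod>k\<in>UNIV. moeb_weight (lam $ k) (a k) (w $ k)) * base_kernel lam (?\<psi> z) (?\<psi> w)"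
    unfolding base_kernel_def cnj_prod prod.distrib[symmetric] df unfolding dfac_def
    by (intro prod.cong refl moeb_weight_cofactor u a zk wk)
  have col: "cnj (y $ k) / dfac x y k = moeb_logderiv (a k) (x $ k)
      + moeb_deriv (u k) (a k) (x $ k) * (cnj (?\<psi> y $ k) / dfac (?\<psi> x) (?\<psi> y) k)"
    if "x \<in> polydisc" "y \<in> polydisc" for x y k
    using moeb_jet_col[of "u k" "a k" "x $ k" "y $ k"] u a that
    by (simp add: dfac_def moeb_poly_def polydisc_def)
  have diag: "c / (dfac z w k)\<^sup>2 = moeb_deriv (u k) (a k) (z $ k) * cnj (moeb_deriv (u k) (a k) (w $ k))
      * (c / (dfac (?\<psi> z) (?\<psi> w) k)\<^sup>2)" for k c
    using arg_cong[OF moeb_deriv_cofactor[OF u[of k] a[of k] zk[of k] wk[of k]], of "\<lambda>v. c * v"]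
    unfolding df unfolding dfac_def by (simp add: mult_ac)
  let ?Q = "jet_col i j (?\<psi> z) (?\<psi> w)" and ?P = "\<lambda>q. cnj (jet_col i j (?\<psi> w) (?\<psi> z) q)"
  have Q: "jet_col i j z w p = (if p = 2 then moeb_logderiv (a i) (z $ i) + moeb_deriv (u i) (a i) (z $ i) * ?Q 2
      else if p = 3 then moeb_logderiv (a j) (z $ j) + moeb_deriv (u j) (a j) (z $ j) * ?Q 3 else 1)" for p
    unfolding jet_col_def by (simp add: col[OF z w])
  have P: "cnj (jet_col i j w z q) =
      (if q = 2 then cnj (moeb_logderiv (a i) (w $ i)) + cnj (moeb_deriv (u i) (a i) (w $ i)) * ?P 2
      else if q = 3 then cnj (moeb_logderiv (a j) (w $ j)) + cnj (moeb_deriv (u j) (a j) (w $ j)) * ?P 3 else 1)" for q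
    unfolding jet_col_def by (simp add: col[OF w z])
  let ?X = "\<lambda>k c. of_real c / (dfac (?\<psi> z) (?\<psi> w) k)\<^sup>2"
  have K': "kernelA i j lam mu (?\<psi> z) (?\<psi> w) $ r $ s = base_kernel lam (?\<psi> z) (?\<psi> w) *
      (?Q r * ?P s + of_bool (r = 2 \<and> s = 2) * ?X i (1 / lam $ i + (mu $ 1)\<^sup>2)
        + of_bool (r = 3 \<and> s = 3) * ?X j (1 / lam $ j + (mu $ 2)\<^sup>2))" for r s
    using kernelA_nth[OF ij \<psi>z \<psi>w, of lam mu r s] by simp
  have "kernelA i j lam mu z w $ p $ q = (moeb_cocycle i j lam u a z
    ** kernelA i j lam mu (?\<psi> z) (?\<psi> w) ** adj_mat (moeb_cocycle i j lam u a w)) $ p $ q" for p q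
    unfolding moeb_cocycle_def
    by (subst lower3_conj_nth[OF K'])
      (simp_all only: kernelA_nth[OF ij z w] times_divide_eq_right[symmetric] S Q P diag[of _ i] diag[of _ j],
       simp_all add: jet_col_def)
  then show ?thesis by (simp add: vec_eq_iff)
qed

lemma moeb_cocycle_invertible:
  assumes u: "\<And>k. norm (u k) = 1" and a: "\<And>k. norm (a k) < 1" and z: "z \<in> polydisc"
  shows "invertible (moeb_cocycle i j lam u a z)"
proof -
  have nz: "1 - cnj (a k) * z $ k \<noteq> 0" "complex_of_real (1 - (cmod (a k))\<^sup>2) \<noteq> 0" "u k \<noteq> 0"
    "1 - (cmod (a k))\<^sup>2 > 0" for k
  proof -
    have zk: "norm (z $ k) < 1" using z by (simp add: polydisc_def)
    show "1 - cnj (a k) * z $ k \<noteq> 0" using moeb_denom(1)[OF a[of k] zk zk] .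
    show "1 - (cmod (a k))\<^sup>2 > 0" using one_minus_norm_sq_pos[OF a[of k]] .
    then show "complex_of_real (1 - (cmod (a k))\<^sup>2) \<noteq> 0" by (metis of_real_eq_0_iff less_irrefl)
    show "u k \<noteq> 0" using u[of k] by auto
  qed
  have "(cmod (a k))\<^sup>2 \<noteq> 1" for k using nz(4)[of k] by linarith
  then have "(\<Prod>k\<in>UNIV. moeb_weight (lam $ k) (a k) (z $ k)) \<noteq> 0"
    using nz(1) by (simp add: moeb_weight_def)
  moreover have "moeb_deriv (u k) (a k) (z $ k) \<noteq> 0" for k
    unfolding moeb_deriv_def using nz by (simp only: divide_eq_0_iff mult_eq_0_iff power_eq_0_iff) simp
  ultimately have "det (moeb_cocycle i j lam u a z) \<noteq> 0"
    by (simp add: moeb_cocycle_def lower3_def det_3)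
  then show ?thesis by (simp add: invertible_det_nz)
qed

section \<open>The functional calculus and homogeneity\<close>

lemma sum_apply: "(\<Sum>k\<in>A. h k) z = (\<Sum>k\<in>A. h k z)"
  for h :: "'k \<Rightarrow> 'a \<Rightarrow> 'b::comm_monoid_add"
  by (induction A rule: infinite_finite_induct) (simp_all add: zero_fun_def plus_fun_def)

lemma coord_mult_power: "(coord_mult k ^^ m) f z = (z $ k) ^ m *s f z"
  by (induction m) (simp_all add: coord_mult_def vector_smult_assoc)

lemma bounded_operator_cong:
  assumes T: "bounded_operator H T" and eq: "\<And>x. x \<in> vecs H \<Longrightarrow> T' x = T x" and H: "chilbert_space H"
  shows "bounded_operator H T'"
proof -
  interpret chilbert_space H by (rule H)
  show ?thesis
    using T unfolding bounded_operator_def linear_operator_def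
    by (simp add: eq add_mem scl_mem Pi_iff)
qed

lemma moeb_map_in_moeb: assumes a: "norm a < 1" shows "moeb_map 1 a \<in> moeb"
proof -
  have eq: "moeb_map 1 a = Moebius_function 0 a"
    by (simp add: fun_eq_iff moeb_map_def Moebius_function_simple)
  have ma: "norm (- a) < 1" using a by simp
  show ?thesis
    unfolding moeb_def eq mem_Collect_eq
    using a Moebius_function_holomorphic[OF a] Moebius_function_holomorphic[OF ma]
      Moebius_function_norm_lt_1[OF a] Moebius_function_norm_lt_1[OF ma]
      Moebius_function_compose[of "- a" a] Moebius_function_compose[of a "- a"]
    by (intro conjI exI[of _ "Moebius_function 0 (- a)"]) auto
qed

lemma moeb_inverse:
  assumes "g \<in> moeb"
  shows "\<exists>h\<in>moeb. \<forall>z\<in>ball 0 1. h (g z) = z \<and> g (h z) = z"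
  using assms unfolding moeb_def by blast

lemma moeb_norm_lt_1: "g \<in> moeb \<Longrightarrow> norm z < 1 \<Longrightarrow> norm (g z) < 1"
  unfolding moeb_def by (auto simp: image_subset_iff)

locale spaceA =
  fixes i j :: "'n::finite" and lam :: "real^'n" and mu :: "real^2"
    and H :: "(complex^'n \<Rightarrow> complex^3) hilbert"
  assumes ij: "i \<noteq> j" and lam: "\<forall>k. lam $ k > 0" and mu: "mu $ 1 > 0" "mu $ 2 > 0"
    and H: "is_spaceA i j lam mu H"

sublocale spaceA \<subseteq> rkhs polydisc "kernelA i j lam mu" H
  using H by unfold_locales (simp add: is_spaceA_def)

context spaceA
begin

lemma bounded_coord_mult: "bounded_operator H (coord_mult k)"
proof -
  obtain C where C: "C \<ge> 0" "pos_kernel (polydisc \<times> UNIV) (\<lambda>x y.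
    (of_real C - fst x $ k * cnj (fst y $ k)) * kernelA i j lam mu (fst x) (fst y) $ snd x $ snd y)"
    using shift_kernelA_pos[OF ij lam mu, of k] by blast
  have "bounded_operator H (\<lambda>f z. z $ k *s f z)"
    using bounded_operator_mult[of "sqrt C" "\<lambda>z. z $ k"] C by (simp add: kfun_def)
  then show ?thesis by (simp add: coord_mult_def[abs_def])
qed

text \<open>
  The weighted composition is formed with the inverses of the \<open>g k\<close>, so that multiplication by
  \<open>z $ k\<close> pulls back to multiplication by \<open>g k (z $ k)\<close>.
\<close>

lemma moebius_unitary:
  assumes g: "\<And>k. g k \<in> moeb"
  shows "\<exists>U V. unitary_operator H U \<and> unitary_operator H V \<and> (\<forall>f\<in>vecs H. U (V f) = f) \<and>
    (\<forall>k. \<forall>f\<in>vecs H. \<forall>z. V (coord_mult k (U f)) z = g k (z $ k) *s f z)"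
proof -
  obtain h where h: "\<And>k. h k \<in> moeb" "\<And>k z. norm z < 1 \<Longrightarrow> h k (g k z) = z"
    "\<And>k z. norm z < 1 \<Longrightarrow> g k (h k z) = z"
    using moeb_inverse[OF g] by (metis mem_ball_0)
  have "\<exists>u a. norm u = 1 \<and> norm a < 1 \<and> (\<forall>z. norm z < 1 \<longrightarrow> h k z = moeb_map u a z)" for k
    using moeb_normal_form[OF h(1)[of k]] by metis
  then obtain u a where u: "\<And>k. norm (u k) = 1" and a: "\<And>k. norm (a k) < 1"
    and hk: "\<And>k z. norm z < 1 \<Longrightarrow> h k z = moeb_map (u k) (a k) z" by metis
  define \<psi> where "\<psi> = moeb_poly u a"
  define \<phi> :: "complex^'n \<Rightarrow> complex^'n" where "\<phi> z = (\<chi> k. g k (z $ k))" for z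
  have \<psi>k: "\<psi> z $ k = h k (z $ k)" if "z \<in> polydisc" for z k
    using that by (simp add: \<psi>_def moeb_poly_def polydisc_def hk)
  have \<psi>: "\<psi> z \<in> polydisc" if "z \<in> polydisc" for z
    using \<psi>k[OF that] that moeb_norm_lt_1[OF h(1)] by (simp add: polydisc_def)
  have \<phi>: "\<phi> z \<in> polydisc" if "z \<in> polydisc" for z
    using that moeb_norm_lt_1[OF g] by (simp add: polydisc_def \<phi>_def)
  have \<psi>\<phi>: "\<psi> (\<phi> z) = z" if "z \<in> polydisc" for z
    using \<psi>k[OF \<phi>[OF that]] that h(2) by (simp add: vec_eq_iff \<phi>_def polydisc_def)
  have \<phi>\<psi>: "\<phi> (\<psi> z) = z" if "z \<in> polydisc" for z
    using \<psi>k[OF that] that h(3) by (simp add: vec_eq_iff \<phi>_def polydisc_def)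
  define J where "J = moeb_cocycle i j lam u a"
  have "\<exists>B. B ** J (\<phi> z) = mat 1" if "z \<in> polydisc" for z
    using moeb_cocycle_invertible[where u = u and a = a, OF u a \<phi>[OF that], of i j lam] by (auto simp: J_def invertible_def)
  then obtain J' where J': "\<And>z. z \<in> polydisc \<Longrightarrow> J' z ** J (\<phi> z) = mat 1" by metis
  have K: "kernelA i j lam mu z w = J z ** kernelA i j lam mu (\<psi> z) (\<psi> w) ** adj_mat (J w)"
    if "z \<in> polydisc" "w \<in> polydisc" for z w
    unfolding J_def \<psi>_def
    by (rule kernelA_quasi_invariant[where u = u and a = a, OF ij u a that])
      (use \<psi>[OF that(1)] \<psi>[OF that(2)] in \<open>simp_all add: \<psi>_def\<close>)
  note WU = weighted_comp_unitary[of \<psi> \<phi> J' J, OF \<psi> \<phi> \<psi>\<phi> \<phi>\<psi> J' K]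
  let ?U = "weighted_comp J \<psi>" and ?V = "weighted_comp J' \<phi>"
  have "unitary_operator H ?U" "unitary_operator H ?V"
    by (rule WU; assumption)+
  moreover have "?U (?V f) = f" if "f \<in> vecs H" for f
    by (rule WU(3)) (assumption | rule that)+
  moreover have "?V (coord_mult k (?U f)) z = g k (z $ k) *s f z" if "f \<in> vecs H" for k f z
  proof (cases "z \<in> polydisc")
    case True
    have "?V (coord_mult k (?U f)) z = J' z *v (\<phi> z $ k *s (J (\<phi> z) *v f (\<psi> (\<phi> z))))"
      using True by (simp add: weighted_comp_def coord_mult_def \<phi>)
    also have "\<dots> = \<phi> z $ k *s ((J' z ** J (\<phi> z)) *v f (\<psi> (\<phi> z)))"
      by (simp add: matrix_vector_mul_assoc vector_scalar_commute)
    finally show ?thesis using True by (simp add: J' \<psi>\<phi>) (simp add: \<phi>_def)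
  qed (simp add: weighted_comp_def vanish[OF that])
  ultimately show ?thesis by blast
qed

lemma bounded_moeb_mult:
  assumes g: "\<And>k. g k \<in> moeb"
  shows "bounded_operator H (\<lambda>f z. g k (z $ k) *s f z)"
proof -
  obtain U V where UV: "unitary_operator H U" "unitary_operator H V"
    "\<And>f. f \<in> vecs H \<Longrightarrow> U (V f) = f"
    "\<And>k f z. f \<in> vecs H \<Longrightarrow> V (coord_mult k (U f)) z = g k (z $ k) *s f z"
    using moebius_unitary[of g, OF g] by blast
  have "bounded_operator H (\<lambda>f. V (coord_mult k (U f)))"
    by (rule bounded_operator_compose[OF bounded_operator_unitary[OF UV(2)]
          bounded_operator_compose[OF bounded_coord_mult bounded_operator_unitary[OF UV(1)]]])
  then show ?thesis
    by (rule bounded_operator_cong[OF _ _ chilbert_space_axioms]) (simp add: UV(4) fun_eq_iff)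
qed

text \<open>
  Since \<open>1 + cnj a (z - a) / (1 - cnj a z) = (1 - \<bar>a\<bar>\<^sup>2) / (1 - cnj a z)\<close>, the resolvent is a linear
  combination of the identity and multiplication by a disc automorphism.
\<close>

lemma bounded_resolvent:
  assumes a: "norm a < 1"
  shows "bounded_operator H (\<lambda>f z. (1 / (1 - cnj a * z $ k)) *s f z)"
proof -
  define T :: "(complex^'n \<Rightarrow> complex^3) \<Rightarrow> complex^'n \<Rightarrow> complex^3"
    where "T f z = moeb_map 1 a (z $ k) *s f z" for f z
  have T: "bounded_operator H T"
    using bounded_moeb_mult[of "\<lambda>_. moeb_map 1 a" k] moeb_map_in_moeb[OF a] by (simp add: T_def[abs_def])
  have "bounded_operator H (\<lambda>f. scl H (1 / (1 - a * cnj a)) (f + scl H (cnj a) (T f)))"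
    by (intro bounded_operator_scl[of "\<lambda>f. f + scl H (cnj a) (T f)"] bounded_operator_scl[OF T]
        bounded_operator_add[OF bounded_operator_id])
  then show ?thesis
  proof (rule bounded_operator_cong[OF _ _ chilbert_space_axioms])
    fix f assume f: "f \<in> vecs H"
    show "(\<lambda>z. (1 / (1 - cnj a * z $ k)) *s f z) = scl H (1 / (1 - a * cnj a)) (f + scl H (cnj a) (T f))"
    proof
      fix z
      show "(1 / (1 - cnj a * z $ k)) *s f z = scl H (1 / (1 - a * cnj a)) (f + scl H (cnj a) (T f)) z"
      proof (cases "z \<in> polydisc")
        case True
        have zk: "norm (z $ k) < 1" using True by (simp add: polydisc_def)
        have nz: "1 - cnj a * z $ k \<noteq> 0" "1 - a * cnj a \<noteq> 0"
          using moeb_denom(1)[OF a zk zk] one_minus_norm_sq_nonzero[OF a] by simp_all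
        have "1 / (1 - cnj a * z $ k) = (1 / (1 - a * cnj a)) * (1 + cnj a * moeb_map 1 a (z $ k))"
          using nz by (simp add: moeb_map_def divide_simps) (simp add: algebra_simps)
        then show ?thesis
          by (simp add: scl_eq T_def vec_eq_iff algebra_simps)
      next
        case False
        then show ?thesis by (simp add: scl_eq T_def vanish[OF f])
      qed
    qed
  qed
qed

text \<open>
  If \<open>\<bar>\<zeta>\<^sub>k\<bar> > 1\<close>, then \<open>1 / (z\<^sub>k - \<zeta>\<^sub>k) = -\<zeta>\<^sub>k\<^sup>-\<^sup>1 / (1 - cnj a z\<^sub>k)\<close> with \<open>cnj a = 1 / \<zeta>\<^sub>k\<close> in the disc.
\<close>

lemma taylor_spectrum_coord_mult:
  "taylor_spectrum H coord_mult \<subseteq> {\<zeta>. \<forall>k. norm (\<zeta> $ k) \<le> 1}"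
proof (rule subsetI, rule ccontr)
  fix \<zeta> assume \<zeta>: "\<zeta> \<in> taylor_spectrum H coord_mult" "\<zeta> \<notin> {\<zeta>. \<forall>k. norm (\<zeta> $ k) \<le> 1}"
  then obtain k where k: "norm (\<zeta> $ k) > 1" by (auto simp: not_le)
  let ?c = "\<zeta> $ k"
  let ?B = "\<lambda>l f. coord_mult l f - scl H (\<zeta> $ l) f"
  define a where "a = cnj (1 / ?c)"
  have a: "norm a < 1" using k less_trans[OF zero_less_one k] by (simp add: a_def norm_divide divide_less_eq)
  have c0: "?c \<noteq> 0" using k by auto
  let ?R = "\<lambda>f. scl H (- 1 / ?c) (\<lambda>z. (1 / (1 - cnj a * z $ k)) *s f z)"
  have R: "linear_operator H ?R"
    using bounded_operator_scl[OF bounded_resolvent[OF a]] by (auto simp: bounded_operator_def)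
  have B: "linear_operator H (?B l)" for l
  proof -
    have "bounded_operator H (\<lambda>f. coord_mult l f + scl H (- (\<zeta> $ l)) f)"
      by (intro bounded_operator_add bounded_coord_mult bounded_operator_scl[OF bounded_operator_id])
    then have "bounded_operator H (?B l)"
      by (rule bounded_operator_cong[OF _ _ chilbert_space_axioms]) (simp add: fun_eq_iff scl_eq)
    then show ?thesis by (simp add: bounded_operator_def)
  qed
  have ring: "A * (r * (x * y - c * y)) = A * r * (x - c) * y"
    and ring': "A * (r * (x * y - c * y)) = x * (A * (r * y)) - c * (A * (r * y))"
    for A r x y c :: complex by (simp_all add: algebra_simps)
  have inv: "?R (?B k f) = f" if f: "f \<in> vecs H" for f
  proof
    fix z
    show "?R (?B k f) z = f z"
    proof (cases "z \<in> polydisc")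
      case True
      then have "norm (z $ k) < 1" by (simp add: polydisc_def)
      then have ne: "?c \<noteq> z $ k" using k by auto
      have "(- 1 / ?c) * (1 / (1 - cnj a * z $ k)) * (z $ k - ?c) = 1"
        using c0 ne by (simp add: a_def divide_simps)
      moreover have "?R (?B k f) z = ((- 1 / ?c) * (1 / (1 - cnj a * z $ k)) * (z $ k - ?c)) *s f z"
        unfolding scl_eq coord_mult_def minus_apply vec_eq_iff vector_smult_component
          vector_minus_component by (intro allI ring)
      ultimately show ?thesis by simp
    qed (simp add: scl_eq coord_mult_def vanish[OF f])
  qed
  have comm: "?R (?B l f) = ?B l (?R f)" for l f
    unfolding fun_eq_iff scl_eq coord_mult_def minus_apply vec_eq_iff vector_smult_component
      vector_minus_component by (intro allI ring')
  have "koszul_exact H ?B"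
    by (rule koszul_exact_if_invertible[where k = k and B = ?B and R = ?R])
      (rule B R inv comm | assumption)+
  with \<zeta>(1) show False by (simp add: taylor_spectrum_def)
qed

lemma poly_operator_coord_mult: "poly_operator H p (coord_mult k) f z = poly p (z $ k) *s f z"
  by (simp add: poly_operator_def sum_apply scl_eq coord_mult_power poly_altdef vec_eq_iff
      sum_distrib_right mult.assoc)

lemma is_apply_moeb:
  assumes g: "g \<in> moeb" and S: "\<And>f z. f \<in> vecs H \<Longrightarrow> S f z = g (z $ k) *s f z"
  shows "is_apply H g (coord_mult k) S"
proof -
  obtain u a where u: "norm u = 1" and a: "norm a < 1"
    and gz: "\<And>z. norm z < 1 \<Longrightarrow> g z = moeb_map u a z"
    using moeb_normal_form[OF g] by metis
  let ?p = "[:- u * a, u:]" and ?q = "[:1, - cnj a:]"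
  let ?R = "\<lambda>f z. (1 / (1 - cnj a * z $ k)) *s f z"
  have nz: "1 - cnj a * z \<noteq> 0" if "norm z < 1" for z
    using moeb_denom(1)[OF a that that] .
  have q: "poly ?q z = 1 - cnj a * z" and p: "poly ?p z = u * (z - a)" for z
    by (simp_all add: algebra_simps)
  have "bounded_operator H (\<lambda>f. f + scl H (- cnj a) (coord_mult k f))"
    by (intro bounded_operator_add bounded_operator_id bounded_operator_scl bounded_coord_mult)
  then have Q: "bounded_operator H (poly_operator H ?q (coord_mult k))"
    by (rule bounded_operator_cong[OF _ _ chilbert_space_axioms])
      (simp add: fun_eq_iff poly_operator_coord_mult scl_eq coord_mult_def vec_eq_iff algebra_simps)
  have inv: "?R (poly_operator H ?q (coord_mult k) f) = f \<and> poly_operator H ?q (coord_mult k) (?R f) = f"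
    if f: "f \<in> vecs H" for f
  proof -
    have "?R (poly_operator H ?q (coord_mult k) f) z = f z \<and> poly_operator H ?q (coord_mult k) (?R f) z = f z" for z
    proof (cases "z \<in> polydisc")
      case True
      then have "1 - cnj a * z $ k \<noteq> 0" by (intro nz) (simp add: polydisc_def)
      then show ?thesis unfolding poly_operator_coord_mult q by (simp only: vector_smult_assoc) simp
    qed (simp add: poly_operator_coord_mult vanish[OF f])
    then show ?thesis by blast
  qed
  have "S f = poly_operator H ?p (coord_mult k) (?R f)" if f: "f \<in> vecs H" for f
  proof
    fix z
    show "S f z = poly_operator H ?p (coord_mult k) (?R f) z"
    proof (cases "z \<in> polydisc")
      case True
      then have "norm (z $ k) < 1" by (simp add: polydisc_def)
      then show ?thesis
        unfolding S[OF f] poly_operator_coord_mult p vector_smult_assoc by (simp add: gz moeb_map_def)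
    qed (simp add: S[OF f] poly_operator_coord_mult vanish[OF f])
  qed
  moreover have "poly ?q z \<noteq> 0 \<and> g z = poly ?p z / poly ?q z" if "z \<in> ball 0 1" for z
    unfolding q p using that nz[of z] gz[of z] by (simp add: moeb_map_def)
  moreover have "inverse_operators H (poly_operator H ?q (coord_mult k)) ?R"
    using Q bounded_resolvent[OF a, of k] inv by (simp add: inverse_operators_def)
  ultimately show ?thesis unfolding is_apply_def by blast
qed

lemma homogeneous: "homogeneous_tuple H coord_mult"
  unfolding homogeneous_tuple_def
proof (intro conjI allI impI)
  show "chilbert_space H" by (rule chilbert_space_axioms)
  show "commuting_tuple H coord_mult"
    using bounded_coord_mult
    by (simp add: commuting_tuple_def coord_mult_def vector_smult_assoc mult.commute)
  show "taylor_spectrum H coord_mult \<subseteq> {\<zeta>. \<forall>k. norm (\<zeta> $ k) \<le> 1}"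
    by (rule taylor_spectrum_coord_mult)
  fix g :: "'n \<Rightarrow> complex \<Rightarrow> complex" assume "\<forall>k. g k \<in> moeb"
  then have g: "\<And>k. g k \<in> moeb" by blast
  obtain U V where UV: "unitary_operator H U" "unitary_operator H V"
    "\<And>f. f \<in> vecs H \<Longrightarrow> U (V f) = f"
    "\<And>k f z. f \<in> vecs H \<Longrightarrow> V (coord_mult k (U f)) z = g k (z $ k) *s f z"
    using moebius_unitary[of g, OF g] by blast
  let ?S = "\<lambda>k f. V (coord_mult k (U f))"
  have "is_apply H (g k) (coord_mult k) (?S k)" for k
    by (rule is_apply_moeb) (rule g UV(4) | assumption)+
  moreover have "coord_mult k (U f) \<in> vecs H" if "f \<in> vecs H" for k f
    by (intro bounded_operator_mem[OF bounded_coord_mult] bounded_operator_mem[OF bounded_operator_unitary[OF UV(1)]] that)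
  then have "unitarily_equivalent H ?S coord_mult"
    unfolding unitarily_equivalent_def using UV(1,3) by blast
  ultimately show "\<exists>S. (\<forall>k. is_apply H (g k) (coord_mult k) (S k)) \<and> unitarily_equivalent H S coord_mult"
    by (intro exI[of _ ?S]) simp
qed

end

theorem theorem7p5:
  fixes i j :: "'n::finite" and lam :: "real^'n" and mu :: "real^2"
    and H :: "(complex^'n \<Rightarrow> complex^3) hilbert"
  assumes "i \<noteq> j"
    and "\<forall>k. lam $ k > 0"
    and "mu $ 1 > 0" and "mu $ 2 > 0"
    and "is_spaceA i j lam mu H"
  shows "homogeneous_tuple H coord_mult"
proof -
  interpret spaceA i j lam mu H
    using assms by unfold_locales
  show ?thesis by (rule homogeneous)
qed

end
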